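(* Let $n\ge 2$ be any integer (prime or composite), $d\ge 1$, $\alpha>1$, and let $\{\gamma_{u}\}_{u\subset\mathbb N}$ be positive weights with $\gamma_\emptyset=1$. Let $\mathbf z=(z_1,\ldots,z_d)\in\mathbb U_n^d$ be a generating vector produced by the component-by-component (CBC) algorithm described in the context. Then for every $\lambda\in(\frac1\alpha,1]$, $$S_{n,d,\alpha,\boldsymbol\gamma}(\mathbf z)\le\Bigg[\frac{\kappa}{\varphi(n)}\bigg(\sum_{\emptyset\ne u\subseteq\{1:d\}}|u|\,\gamma_u^{\lambda}[2\zeta(\alpha\lambda)]^{|u|}\bigg)\bigg(\sum_{u\subseteq\{1:d\}}\gamma_u^{\lambda}[2\zeta(\alpha\lambda)]^{|u|}\bigg)\Bigg]^{1/\lambda},$$ where $\kappa:=2^{2\alpha\lambda+1}+1$.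
   Context: Notation: $\{1:d\}=\{1,\ldots,d\}$, $\{s+1:d\}=\{s+1,\ldots,d\}$ (empty if $s=d$); $\zeta(x)=\sum_{h\ge1}h^{-x}$ is the Riemann zeta function. Weights $\boldsymbol\gamma=\{\gamma_u\}$ are positive reals indexed by finite subsets $u\subset\mathbb N$, with $\gamma_\emptyset=1$. For $\mathbf h\in\mathbb Z^d$, $\mathrm{supp}(\mathbf h)=\{j:h_j\neq0\}$ and $r_{d,\alpha,\boldsymbol\gamma}(\mathbf h)=\gamma_{\mathrm{supp}(\mathbf h)}^{-1}\prod_{j\in\mathrm{supp}(\mathbf h)}|h_j|^\alpha$ (so it equals $1$ at $\mathbf h=\mathbf 0$); also $r'(\mathbf h)=\prod_{j\in\mathrm{supp}(\mathbf h)}|h_j|^\alpha$. Let $\mathbb U_n=\{z\in\mathbb Z:1\le z\le n-1,\ \gcd(z,n)=1\}$ and $\varphi(n)=|\mathbb U_n|$ (Euler's totient). "$a\equiv_n b$" means congruence mod $n$. Define $$S_{n,d,\alpha,\boldsymbol\gamma}(\mathbf z)=\sum_{\mathbf h\in\mathbb Z^d}\frac{1}{r_{d,\alpha,\boldsymbol\gamma}(\mathbf h)}\sum_{\substack{\boldsymbol\ell\in\mathbb Z^d\setminus\{\mathbf 0\}\\ \boldsymbol\ell\cdot\mathbf z\equiv_n0}}\frac{1}{r_{d,\alpha,\boldsymbol\gamma}(\mathbf h+\boldsymbol\ell)}.$$ For $s\ge1$, integers $z_1,\ldots,z_s$ and a family of numbers $\{\beta_u\}_{u\subseteq\{1:s\}}$,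 define $$\theta_{n,s,\alpha}(z_1,\ldots,z_s;\{\beta_u\})=\sum_{\mathbf h\in\mathbb Z^s}\sum_{\substack{\boldsymbol\ell\in\mathbb Z^s,\ \ell_s\ne0\\ \boldsymbol\ell\cdot(z_1,\ldots,z_s)\equiv_n0}}\frac{\beta_{\mathrm{supp}(\mathbf h)}}{r'(\mathbf h)}\frac{\beta_{\mathrm{supp}(\mathbf h+\boldsymbol\ell)}}{r'(\mathbf h+\boldsymbol\ell)},$$ and for $1\le s\le d$, $$T_{n,d,s,\alpha,\boldsymbol\gamma}(z_1,\ldots,z_s)=\sum_{w\subseteq\{s+1:d\}}[2\zeta(2\alpha)]^{|w|}\,\theta_{n,s,\alpha}\big(z_1,\ldots,z_s;\{\gamma_{u\cup w}\}_{u\subseteq\{1:s\}}\big).$$ CBC algorithm (for given $n,d,\alpha,\boldsymbol\gamma$): for $s=1,\ldots,d$ in turn, with $z_1,\ldots,z_{s-1}$ already fixed, choose $z_s\in\mathbb U_n$ minimizing $T_{n,d,s,\alpha,\boldsymbol\gamma}(z_1,\ldots,z_{s-1},z_s)$. *)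

theory Defs
  imports "HOL-Analysis.Analysis" "HOL-Number_Theory.Number_Theory"
begin

text \<open>Vectors in Z^d are functions nat => int supported on the coordinates {1..d}.\<close>
definition vecs :: "nat \<Rightarrow> (nat \<Rightarrow> int) set" where
  "vecs d = {h. \<forall>j. j \<notin> {1..d} \<longrightarrow> h j = 0}"

definition supp :: "(nat \<Rightarrow> int) \<Rightarrow> nat set" where
  "supp h = {j. h j \<noteq> 0}"

definition dotp :: "nat \<Rightarrow> (nat \<Rightarrow> int) \<Rightarrow> (nat \<Rightarrow> int) \<Rightarrow> int" where
  "dotp d l z = (\<Sum>j\<in>{1..d}. l j * z j)"

definition zeta :: "real \<Rightarrow> real" where
  "zeta x = (\<Sum>h. 1 / (real (Suc h)) powr x)"

definition rprime :: "real \<Rightarrow> (nat \<Rightarrow> int) \<Rightarrow> real" where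
  "rprime \<alpha> h = (\<Prod>j\<in>supp h. (real_of_int \<bar>h j\<bar>) powr \<alpha>)"

definition rfun :: "real \<Rightarrow> (nat set \<Rightarrow> real) \<Rightarrow> (nat \<Rightarrow> int) \<Rightarrow> real" where
  "rfun \<alpha> \<gamma> h = rprime \<alpha> h / \<gamma> (supp h)"

definition Un_set :: "nat \<Rightarrow> int set" where
  "Un_set n = {z. 1 \<le> z \<and> z \<le> int n - 1 \<and> gcd z (int n) = 1}"

definition S_err :: "nat \<Rightarrow> nat \<Rightarrow> real \<Rightarrow> (nat set \<Rightarrow> real) \<Rightarrow> (nat \<Rightarrow> int) \<Rightarrow> ennreal" where
  "S_err n d \<alpha> \<gamma> z =
     (\<Sum>\<^sub>\<infinity>h\<in>vecs d. ennreal (1 / rfun \<alpha> \<gamma> h) *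
        (\<Sum>\<^sub>\<infinity>l\<in>{l \<in> vecs d. l \<noteq> (\<lambda>_. 0) \<and> [dotp d l z = 0] (mod int n)}.
            ennreal (1 / rfun \<alpha> \<gamma> (\<lambda>j. h j + l j))))"

definition theta :: "nat \<Rightarrow> nat \<Rightarrow> real \<Rightarrow> (nat \<Rightarrow> int) \<Rightarrow> (nat set \<Rightarrow> real) \<Rightarrow> ennreal" where
  "theta n s \<alpha> z \<beta> =
     (\<Sum>\<^sub>\<infinity>h\<in>vecs s.
        (\<Sum>\<^sub>\<infinity>l\<in>{l \<in> vecs s. l s \<noteq> 0 \<and> [dotp s l z = 0] (mod int n)}.
            ennreal (\<beta> (supp h) / rprime \<alpha> h) *
            ennreal (\<beta> (supp (\<lambda>j. h j + l j)) / rprime \<alpha> (\<lambda>j. h j + l j))))"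

definition T_crit :: "nat \<Rightarrow> nat \<Rightarrow> nat \<Rightarrow> real \<Rightarrow> (nat set \<Rightarrow> real) \<Rightarrow> (nat \<Rightarrow> int) \<Rightarrow> ennreal" where
  "T_crit n d s \<alpha> \<gamma> z =
     (\<Sum>w\<in>Pow {s+1..d}. ennreal ((2 * zeta (2 * \<alpha>)) ^ card w) *
        theta n s \<alpha> z (\<lambda>u. \<gamma> (u \<union> w)))"

text \<open>z (restricted to coordinates 1..d) is a possible output of the CBC algorithm:
  for each s, z_s lies in U_n and minimizes T over U_n given z_1..z_{s-1}.\<close>
definition cbc :: "nat \<Rightarrow> nat \<Rightarrow> real \<Rightarrow> (nat set \<Rightarrow> real) \<Rightarrow> (nat \<Rightarrow> int) \<Rightarrow> bool" where
  "cbc n d \<alpha> \<gamma> z \<longleftrightarrow>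
     (\<forall>s\<in>{1..d}. z s \<in> Un_set n \<and>
        (\<forall>y\<in>Un_set n. T_crit n d s \<alpha> \<gamma> z \<le> T_crit n d s \<alpha> \<gamma> (z(s := y))))"

end

theory Submission
  imports Defs
begin

text \<open>
  Sorting the vectors \<open>l\<close> by their last nonzero coordinate \<open>s\<close> writes the error as the sum over \<open>s\<close> of the CBC
  criteria. By Jensen's inequality \<open>(\<Sum>x)\<^sup>\<lambda> \<le> \<Sum>x\<^sup>\<lambda>\<close> each criterion is controlled by the same double sum with
  weights \<open>\<gamma>\<^sup>\<lambda>\<close> and exponent \<open>a = \<alpha>\<lambda>\<close>, and the minimiser is no worse than the average over the candidates
  for \<open>z\<^sub>s\<close>. Fix all coordinates of \<open>h\<close> and \<open>h + l\<close> except the \<open>s\<close>-th ones, \<open>p\<close> and \<open>q\<close>. The constraint reads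
  \<open>(q - p) y + c \<equiv> 0\<close> modulo \<open>n\<close>; with \<open>g = gcd(c, n)\<close> it has at most \<open>g\<close> solutions \<open>y\<close>, and none unless
  \<open>g\<close> divides \<open>q - p\<close>. Since \<open>max(\<bar>p\<bar>, \<bar>q\<bar>) \<ge> \<bar>q - p\<bar> / 2\<close>, the decay in the multiple \<open>q - p\<close> of \<open>g\<close>
  contributes \<open>g\<^sup>-\<^sup>a\<close>, which absorbs the factor \<open>g\<close> because \<open>a > 1\<close>. This is uniform in \<open>c\<close>, so the
  remaining coordinates can be summed freely.
\<close>

section \<open>Infinite sums of extended nonnegative reals\<close>

lemma infsum_ennreal_le:
  fixes f :: "'a \<Rightarrow> ennreal"
  assumes "\<And>F. finite F \<Longrightarrow> F \<subseteq> A \<Longrightarrow> sum f F \<le> c"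
  shows "infsum f A \<le> c"
  using assms by (auto simp: nonneg_infsum_complete intro!: SUP_least)

lemma sum_le_infsum_ennreal:
  fixes f :: "'a \<Rightarrow> ennreal"
  assumes "finite F" "F \<subseteq> A"
  shows "sum f F \<le> infsum f A"
  using assms by (auto simp: nonneg_infsum_complete intro!: SUP_upper)

lemma infsum_ennreal_mono:
  fixes f :: "'a \<Rightarrow> ennreal"
  assumes "\<And>x. x \<in> A \<Longrightarrow> f x \<le> g x"
  shows "infsum f A \<le> infsum g A"
  by (rule infsum_mono) (use assms in \<open>auto intro: nonneg_summable_on_complete\<close>)

lemma infsum_ennreal_mono_set:
  fixes f :: "'a \<Rightarrow> ennreal"
  assumes "A \<subseteq> B"
  shows "infsum f A \<le> infsum f B"
  by (rule infsum_mono_neutral) (use assms in \<open>auto intro: nonneg_summable_on_complete\<close>)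

lemma infsum_ennreal_cmult:
  fixes f :: "'a \<Rightarrow> ennreal"
  shows "infsum (\<lambda>x. c * f x) A = c * infsum f A"
  by (simp add: nonneg_infsum_complete SUP_mult_left_ennreal sum_distrib_left)

lemma infsum_ennreal_cmult_right:
  fixes f :: "'a \<Rightarrow> ennreal"
  shows "infsum (\<lambda>x. f x * c) A = infsum f A * c"
  using infsum_ennreal_cmult[of c f A] by (simp add: mult.commute)

lemma infsum_ennreal_add:
  fixes f :: "'a \<Rightarrow> ennreal"
  shows "infsum (\<lambda>x. f x + g x) A = infsum f A + infsum g A"
  by (rule infsum_add) (auto intro: nonneg_summable_on_complete)

lemma infsum_ennreal_sum:
  fixes f :: "'b \<Rightarrow> 'a \<Rightarrow> ennreal"
  assumes "finite Y"
  shows "infsum (\<lambda>x. \<Sum>y\<in>Y. f y x) A = (\<Sum>y\<in>Y. infsum (f y) A)"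
  using assms by (induction Y) (auto simp: infsum_ennreal_add)

lemma infsum_ennreal_UN_disjoint:
  fixes f :: "'a \<Rightarrow> ennreal"
  assumes "finite I" "disjoint_family_on A I"
  shows "infsum f (\<Union>i\<in>I. A i) = (\<Sum>i\<in>I. infsum f (A i))"
  using assms
proof (induction I)
  case (insert i I)
  have "A i \<inter> (\<Union>i\<in>I. A i) = {}"
    using insert.prems insert.hyps by (auto simp: disjoint_family_on_def)
  moreover have "disjoint_family_on A I"
    using insert.prems by (auto simp: disjoint_family_on_def)
  ultimately show ?case
    using insert by (simp add: infsum_Un_disjoint nonneg_summable_on_complete)
qed auto

text \<open>Tonelli without summability conditions, by comparing partial sums in both directions. A
  finite set of outer indices carries a disjoint union of fibres inside \<open>Sigma A B\<close>. A
  finite set of pairs is the \<open>Sigma\<close> of its projection and its finite fibres.\<close>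

lemma infsum_ennreal_Sigma:
  fixes f :: "'a \<Rightarrow> 'b \<Rightarrow> ennreal"
  shows "infsum (\<lambda>x. infsum (f x) (B x)) A = infsum (\<lambda>(x, y). f x y) (Sigma A B)"
proof (rule antisym)
  show "infsum (\<lambda>x. infsum (f x) (B x)) A \<le> infsum (\<lambda>(x, y). f x y) (Sigma A B)"
  proof (rule infsum_ennreal_le)
    fix F assume F: "finite F" "F \<subseteq> A"
    have "infsum (f x) (B x) = infsum (\<lambda>(x, y). f x y) ({x} \<times> B x)" for x
      by (rule infsum_reindex_bij_witness[of _ snd "Pair x"]) auto
    then have "(\<Sum>x\<in>F. infsum (f x) (B x)) = (\<Sum>x\<in>F. infsum (\<lambda>(x, y). f x y) ({x} \<times> B x))"
      by simp
    also have "\<dots> = infsum (\<lambda>(x, y). f x y) (\<Union>x\<in>F. {x} \<times> B x)"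
      by (rule infsum_ennreal_UN_disjoint[symmetric]) (use F in \<open>auto simp: disjoint_family_on_def\<close>)
    also have "\<dots> \<le> infsum (\<lambda>(x, y). f x y) (Sigma A B)"
      by (rule infsum_ennreal_mono_set) (use F in auto)
    finally show "(\<Sum>x\<in>F. infsum (f x) (B x)) \<le> infsum (\<lambda>(x, y). f x y) (Sigma A B)" .
  qed
  show "infsum (\<lambda>(x, y). f x y) (Sigma A B) \<le> infsum (\<lambda>x. infsum (f x) (B x)) A"
  proof (rule infsum_ennreal_le)
    fix F assume F: "finite F" "F \<subseteq> Sigma A B"
    let ?G = "\<lambda>x. {y. (x, y) \<in> F}"
    have fin: "finite (?G x)" for x
      by (rule finite_subset[of _ "snd ` F"]) (use F in \<open>force+\<close>)
    have "F = Sigma (fst ` F) ?G"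
      by force
    then have "(\<Sum>(x, y)\<in>F. f x y) = (\<Sum>(x, y)\<in>Sigma (fst ` F) ?G. f x y)"
      by simp
    also have "\<dots> = (\<Sum>x\<in>fst ` F. \<Sum>y\<in>?G x. f x y)"
      by (rule sum.Sigma[symmetric]) (use F fin in auto)
    also have "\<dots> \<le> (\<Sum>x\<in>fst ` F. infsum (f x) (B x))"
      by (intro sum_mono sum_le_infsum_ennreal fin) (use F in auto)
    also have "\<dots> \<le> infsum (\<lambda>x. infsum (f x) (B x)) A"
      by (rule sum_le_infsum_ennreal) (use F in auto)
    finally show "(\<Sum>(x, y)\<in>F. f x y) \<le> infsum (\<lambda>x. infsum (f x) (B x)) A" .
  qed
qed

lemma infsum_ennreal_product:
  fixes f :: "'a \<Rightarrow> ennreal"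
  shows "infsum (\<lambda>x. infsum (\<lambda>y. f x * g y) B) A = infsum f A * infsum g B"
  by (simp add: infsum_ennreal_cmult infsum_ennreal_cmult_right)

text \<open>The tool for discarding constraints. A change of variables has to be injective only,
  because the terms of the target that are not hit are nonnegative.\<close>

lemma infsum_ennreal_inj_le:
  fixes f :: "'a \<Rightarrow> ennreal"
  assumes "inj_on j A" "j ` A \<subseteq> B" "\<And>x. x \<in> A \<Longrightarrow> f x \<le> g (j x)"
  shows "infsum f A \<le> infsum g B"
proof -
  have "infsum f A \<le> infsum (g \<circ> j) A"
    by (rule infsum_ennreal_mono) (use assms in auto)
  also have "\<dots> = infsum g (j ` A)"
    by (rule infsum_reindex[symmetric]) (use assms in auto)
  also have "\<dots> \<le> infsum g B"
    by (rule infsum_ennreal_mono_set) (use assms in auto)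
  finally show ?thesis .
qed

section \<open>Jensen's inequality\<close>

text \<open>Dividing by \<open>x + y\<close> reduces the claim to \<open>t powr p <= t\<close> on
  the unit interval, applied to two numbers that add up to 1.\<close>

lemma add_powr_le_powr_add:
  fixes x y :: real
  assumes "0 \<le> x" "0 \<le> y" "1 \<le> p"
  shows "x powr p + y powr p \<le> (x + y) powr p"
proof (cases "x + y = 0")
  case False
  then have pos: "x + y > 0" using assms by linarith
  have le: "t powr p \<le> t" if "0 \<le> t" "t \<le> 1" for t :: real
    using powr_mono'[of 1 p t] that assms by auto
  have "(x / (x + y)) powr p + (y / (x + y)) powr p \<le> x / (x + y) + y / (x + y)"
    by (intro add_mono le) (use assms pos in auto)
  also have "\<dots> = 1"
    using pos by (simp add: add_divide_distrib[symmetric])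
  finally have "(x powr p + y powr p) / (x + y) powr p \<le> 1"
    using assms pos by (simp add: powr_divide add_divide_distrib)
  then show ?thesis
    using pos by (simp add: divide_le_eq)
qed (use assms in \<open>auto simp: add_nonneg_eq_0_iff\<close>)

lemma sum_powr_le_powr_sum:
  fixes f :: "'a \<Rightarrow> real"
  assumes "\<And>x. x \<in> F \<Longrightarrow> 0 \<le> f x" "1 \<le> p"
  shows "(\<Sum>x\<in>F. f x powr p) \<le> (\<Sum>x\<in>F. f x) powr p"
proof (cases "finite F")
  case True
  then show ?thesis
    using assms(1)
  proof (induction F)
    case (insert x F)
    then have "(\<Sum>x\<in>insert x F. f x powr p) \<le> f x powr p + (\<Sum>x\<in>F. f x) powr p"
      by simp
    also have "\<dots> \<le> (f x + (\<Sum>x\<in>F. f x)) powr p"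
      by (rule add_powr_le_powr_add) (use insert assms in \<open>auto intro: sum_nonneg\<close>)
    finally show ?case
      using insert by simp
  qed auto
qed auto

text \<open>On each finite partial sum, the previous lemma with \<open>p = 1 / lam\<close> is
  applied to the numbers \<open>f x powr lam\<close>, whose powers give back \<open>f x\<close>. The
  bound does not depend on the finite set.\<close>

lemma infsum_le_powr_of_infsum_powr_le:
  fixes f :: "'a \<Rightarrow> real"
  assumes f: "\<And>x. x \<in> A \<Longrightarrow> 0 \<le> f x" and lam: "0 < lam" "lam \<le> 1" and M: "0 \<le> M"
    and le: "(\<Sum>\<^sub>\<infinity>x\<in>A. ennreal (f x powr lam)) \<le> ennreal M"
  shows "(\<Sum>\<^sub>\<infinity>x\<in>A. ennreal (f x)) \<le> ennreal (M powr (1 / lam))"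
proof (rule infsum_ennreal_le)
  fix F assume F: "finite F" "F \<subseteq> A"
  have "ennreal (\<Sum>x\<in>F. f x powr lam) = (\<Sum>x\<in>F. ennreal (f x powr lam))"
    by (rule sum_ennreal[symmetric]) auto
  also have "\<dots> \<le> ennreal M"
    using sum_le_infsum_ennreal[OF F] le by (rule order_trans)
  finally have *: "(\<Sum>x\<in>F. f x powr lam) \<le> M"
    using M by simp
  have "(\<Sum>x\<in>F. f x) = (\<Sum>x\<in>F. (f x powr lam) powr (1 / lam))"
    by (rule sum.cong) (use f F lam in \<open>auto simp: powr_powr\<close>)
  also have "\<dots> \<le> (\<Sum>x\<in>F. f x powr lam) powr (1 / lam)"
    by (rule sum_powr_le_powr_sum) (use lam in auto)
  also have "\<dots> \<le> M powr (1 / lam)"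
    by (rule powr_mono2) (use * lam in \<open>auto intro: sum_nonneg\<close>)
  finally show "(\<Sum>x\<in>F. ennreal (f x)) \<le> ennreal (M powr (1 / lam))"
    using f F by (subst sum_ennreal) (auto intro: ennreal_leI)
qed

section \<open>Sums over integer vectors by support\<close>

lemma supp_eq_empty_iff: "supp h = {} \<longleftrightarrow> h = (\<lambda>_. 0)"
  by (auto simp: supp_def)

text \<open>A vector with support \<open>insert i w\<close> is the same as a nonzero entry at
  \<open>i\<close> together with a vector with support \<open>w\<close>, so each coordinate
  contributes one independent factor.\<close>

lemma infsum_prod_supp_eq:
  fixes c :: "int \<Rightarrow> ennreal"
  assumes "finite w"
  shows "(\<Sum>\<^sub>\<infinity>h\<in>{h. supp h = w}. \<Prod>j\<in>w. c (h j)) = (\<Sum>\<^sub>\<infinity>k\<in>-{0}. c k) ^ card w"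
  using assms
proof (induction w)
  case empty
  have "{h. supp h = {}} = {\<lambda>_. 0}"
    by (auto simp: supp_eq_empty_iff)
  then show ?case by simp
next
  case (insert i w)
  have "(\<Sum>\<^sub>\<infinity>h\<in>{h. supp h = insert i w}. \<Prod>j\<in>insert i w. c (h j))
      = (\<Sum>\<^sub>\<infinity>(k, h)\<in>(-{0}) \<times> {h. supp h = w}. c k * (\<Prod>j\<in>w. c (h j)))"
  proof (rule infsum_reindex_bij_witness[of _ "\<lambda>(k, h). h(i := k)" "\<lambda>h. (h i, h(i := 0))"])
    fix h assume h: "h \<in> {h. supp h = insert i w}"
    show "(case (h i, h(i := 0)) of (k, h) \<Rightarrow> c k * (\<Prod>j\<in>w. c (h j))) = (\<Prod>j\<in>insert i w. c (h j))"
      using insert by (auto intro!: arg_cong[where f = "(*) _"] prod.cong)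
  qed (use insert in \<open>auto simp: supp_def fun_eq_iff split: if_splits\<close>)
  also have "\<dots> = (\<Sum>\<^sub>\<infinity>k\<in>-{0}. c k) * (\<Sum>\<^sub>\<infinity>k\<in>-{0}. c k) ^ card w"
    by (simp add: infsum_ennreal_Sigma[symmetric] infsum_ennreal_product insert.IH)
  finally show ?case
    using insert by simp
qed

text \<open>Since \<open>G\<close> sees only the support, grouping by support leaves a finite sum
  over subsets. This produces both the powers of \<open>2 * zeta (2 * \<alpha>)\<close> in the
  criterion and the subset sums of the final bound.\<close>

lemma infsum_prod_supp_subset:
  fixes c :: "int \<Rightarrow> ennreal"
  assumes "finite J"
  shows "(\<Sum>\<^sub>\<infinity>h\<in>{h. supp h \<subseteq> J}. G (supp h) * (\<Prod>j\<in>supp h. c (h j)))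
    = (\<Sum>w\<in>Pow J. G w * (\<Sum>\<^sub>\<infinity>k\<in>-{0}. c k) ^ card w)"
proof -
  have "{h. supp h \<subseteq> J} = (\<Union>w\<in>Pow J. {h. supp h = w})"
    by auto
  then have "(\<Sum>\<^sub>\<infinity>h\<in>{h. supp h \<subseteq> J}. G (supp h) * (\<Prod>j\<in>supp h. c (h j)))
      = (\<Sum>w\<in>Pow J. \<Sum>\<^sub>\<infinity>h\<in>{h. supp h = w}. G (supp h) * (\<Prod>j\<in>supp h. c (h j)))"
    using assms by (simp only:) (rule infsum_ennreal_UN_disjoint, auto simp: disjoint_family_on_def)
  also have "\<dots> = (\<Sum>w\<in>Pow J. \<Sum>\<^sub>\<infinity>h\<in>{h. supp h = w}. G w * (\<Prod>j\<in>w. c (h j)))"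
    by (intro sum.cong infsum_cong) auto
  also have "\<dots> = (\<Sum>w\<in>Pow J. G w * (\<Sum>\<^sub>\<infinity>k\<in>-{0}. c k) ^ card w)"
    by (intro sum.cong refl)
      (simp add: infsum_ennreal_cmult infsum_prod_supp_eq finite_subset[OF _ assms])
  finally show ?thesis .
qed

section \<open>Sums of powers of integers\<close>

text \<open>One coordinate's factor of a reciprocal of \<open>rprime\<close>. It takes values in
  \<open>ennreal\<close>, so that products and infinite sums can be rearranged freely.\<close>

definition ipow :: "real \<Rightarrow> int \<Rightarrow> ennreal" where
  "ipow a k = ennreal (real_of_int \<bar>k\<bar> powr (- a))"

lemma ipow_uminus [simp]: "ipow a (- k) = ipow a k"
  by (simp add: ipow_def)

lemma summable_zeta:
  assumes "a > 1"
  shows "summable (\<lambda>h. 1 / real (Suc h) powr a)"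
  using summable_Suc_iff[of "\<lambda>h. 1 / real h powr a"] summable_real_powr_iff[of "- a"] assms
  by (simp add: powr_minus_divide)

lemma zeta_pos:
  assumes "a > 1"
  shows "zeta a > 0"
  unfolding zeta_def by (rule suminf_pos[OF summable_zeta[OF assms]]) auto

lemma infsum_ipow:
  assumes "a > 1"
  shows "(\<Sum>\<^sub>\<infinity>k\<in>-{0}. ipow a k) = ennreal (2 * zeta a)"
proof -
  let ?f = "\<lambda>h. 1 / real (Suc h) powr a"
  have "?f sums zeta a"
    unfolding zeta_def using summable_zeta[OF assms] by (rule summable_sums)
  then have hs: "(?f has_sum zeta a) UNIV"
    by (intro sums_nonneg_imp_has_sum) auto
  then have "ennreal (zeta a) = (SUP F\<in>{F. finite F \<and> F \<subseteq> UNIV}. ennreal (sum ?f F))"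
    using infsum_nonneg_is_SUPREMUM_ennreal[of ?f UNIV]
    by (simp add: infsumI has_sum_imp_summable)
  also have "\<dots> = (\<Sum>\<^sub>\<infinity>h. ennreal (?f h))"
    by (subst nonneg_infsum_complete) (simp_all add: sum_ennreal)
  finally have z: "(\<Sum>\<^sub>\<infinity>h. ennreal (?f h)) = ennreal (zeta a)" ..
  have pos: "(\<Sum>\<^sub>\<infinity>k\<in>{0<..}. ipow a k) = ennreal (zeta a)"
    unfolding z[symmetric]
    by (rule infsum_reindex_bij_witness[of _ "\<lambda>h. int (Suc h)" "\<lambda>k. nat (k - 1)"])
      (auto simp: ipow_def powr_minus_divide)
  have neg: "(\<Sum>\<^sub>\<infinity>k\<in>{..<0}. ipow a k) = (\<Sum>\<^sub>\<infinity>k\<in>{0<..}. ipow a k)"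
    by (rule infsum_reindex_bij_witness[of _ uminus uminus]) auto
  have split: "- {0::int} = {0<..} \<union> {..<0}"
    by auto
  have "(\<Sum>\<^sub>\<infinity>k\<in>-{0}. ipow a k) = (\<Sum>\<^sub>\<infinity>k\<in>{0<..}. ipow a k) + (\<Sum>\<^sub>\<infinity>k\<in>{..<0}. ipow a k)"
    unfolding split by (rule infsum_Un_disjoint) (auto simp: nonneg_summable_on_complete)
  also have "\<dots> = ennreal (2 * zeta a)"
    using ennreal_plus[of "zeta a" "zeta a"] zeta_pos[OF assms] unfolding neg pos mult_2 by simp
  finally show ?thesis .
qed

section \<open>Counting solutions of linear congruences\<close>

lemma Un_set_eq_image_totatives:
  assumes "n \<ge> 2"
  shows "Un_set n = int ` totatives n"
proof -
  have "z \<in> int ` totatives n" if "z \<in> Un_set n" for z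
  proof (rule image_eqI)
    show "z = int (nat z)" using that by (auto simp: Un_set_def)
    have "coprime (int (nat z)) (int n)"
      using that by (auto simp: Un_set_def coprime_iff_gcd_eq_1)
    then show "nat z \<in> totatives n"
      using that by (auto simp: Un_set_def totatives_def simp flip: coprime_int_iff)
  qed
  moreover have "int k \<in> Un_set n" if k: "k \<in> totatives n" for k
  proof -
    \<comment> \<open>\<open>totatives n\<close> ranges up to \<open>n\<close> itself. Only
      \<open>n >= 2\<close> excludes that endpoint; for \<open>n = 1\<close> the two sets
      differ.\<close>
    have "k < n" using totatives_less[OF k] assms by simp
    then show ?thesis
      using k by (auto simp: Un_set_def totatives_def simp flip: coprime_iff_gcd_eq_1)
  qed
  ultimately show ?thesis by blast
qed

lemma finite_Un_set [simp]: "finite (Un_set n)"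
  by (rule finite_subset[of _ "{1..int n - 1}"]) (auto simp: Un_set_def)

lemma card_Un_set:
  assumes "n \<ge> 2"
  shows "card (Un_set n) = totient n"
  using assms by (simp add: Un_set_eq_image_totatives card_image totient_def)

text \<open>Let \<open>y0\<close> be a solution. It is a unit modulo \<open>n\<close>, so
  \<open>gcd m n = gcd (m * y0) n = gcd (- c) n = g\<close>; thus a solution forces
  \<open>g dvd m\<close>. Moreover, all solutions agree modulo \<open>n div g\<close>, and there are
  only \<open>g\<close> places for them below \<open>n\<close>.\<close>

lemma card_Un_set_solutions_le:
  fixes c m :: int
  assumes n: "n \<ge> 2"
  defines "g \<equiv> gcd c (int n)"
  shows "int (card {y \<in> Un_set n. [m * y + c = 0] (mod int n)}) \<le> (if g dvd m then g else 0)"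
proof (cases "{y \<in> Un_set n. [m * y + c = 0] (mod int n)} = {}")
  case True
  then show ?thesis by (simp only:) (simp add: g_def)
next
  case False
  let ?S = "{y \<in> Un_set n. [m * y + c = 0] (mod int n)}"
  from False obtain y0 where y0: "y0 \<in> ?S" by blast
  have g0: "g > 0" using n by (simp add: g_def)
  have "gcd m (int n) = gcd (m * y0) (int n)"
    using y0 by (intro gcd_mult_left_right_cancel[symmetric])
      (auto simp: Un_set_def coprime_iff_gcd_eq_1 gcd.commute)
  also have "\<dots> = gcd (- c) (int n)"
  proof (rule cong_gcd_eq)
    show "[m * y0 = - c] (mod int n)"
      using y0 by (simp add: cong_iff_dvd_diff)
  qed
  finally have gm: "gcd m (int n) = g"
    by (simp add: g_def)
  define n' where "n' = int n div g"
  have nn': "int n = n' * g"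
    by (simp add: n'_def g_def)
  have n'0: "n' > 0"
    using nn' g0 n by (metis zero_less_mult_pos2 of_nat_0_less_iff less_le_trans pos2)
  have dv: "n' dvd y - y0" if "y \<in> ?S" for y
  proof -
    have "int n dvd (m * y + c) - (m * y0 + c)"
      using that y0 by (intro dvd_diff) (auto simp: cong_iff_dvd_diff)
    then have "n' * g dvd m * (y - y0)"
      unfolding nn' by (simp add: right_diff_distrib)
    moreover have "m = (m div g) * g"
      using gm by (metis dvd_div_mult_self gcd_dvd1)
    ultimately have "n' * g dvd ((m div g) * (y - y0)) * g"
      by (metis mult.assoc mult.commute)
    then have "n' dvd (m div g) * (y - y0)"
      using g0 by simp
    moreover have "coprime n' (m div g)"
      using div_gcd_coprime[of m "int n"] n gm by (simp add: n'_def coprime_commute)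
    ultimately show ?thesis
      by (simp add: coprime_dvd_mult_right_iff)
  qed
  \<comment> \<open>The residue modulo \<open>n'\<close> is common to all solutions, so the quotient
    \<open>y div n'\<close> identifies a solution. It lies below \<open>g\<close> because
    \<open>y < n = g * n'\<close>.\<close>
  have "card ?S \<le> card {0..<g}"
  proof (rule card_inj_on_le)
    show "inj_on (\<lambda>y. y div n') ?S"
    proof (rule inj_onI)
      fix y y' assume y: "y \<in> ?S" "y' \<in> ?S" and eq: "y div n' = y' div n'"
      have "y mod n' = y' mod n'"
        using dv[OF y(1)] dv[OF y(2)] by (metis mod_eq_dvd_iff)
      with eq show "y = y'"
        by (metis div_mult_mod_eq)
    qed
    show "(\<lambda>y. y div n') ` ?S \<subseteq> {0..<g}"
    proof safe
      fix y assume y: "y \<in> Un_set n"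
      then have "0 \<le> y" "y < g * n'"
        using nn' by (auto simp: Un_set_def mult.commute)
      moreover have "y div n' * n' \<le> y"
        using n'0 div_mult_mod_eq[of y n'] pos_mod_sign[of n' y] by linarith
      ultimately have "y div n' * n' < g * n'"
        by linarith
      with \<open>0 \<le> y\<close> show "y div n' \<in> {0..<g}"
        using n'0 by (simp add: pos_imp_zdiv_nonneg_iff)
    qed
  qed auto
  moreover have "g dvd m"
    using gm by (metis gcd_dvd1)
  ultimately show ?thesis
    using g0 by simp
qed

section \<open>Averaging in one coordinate\<close>

text \<open>The larger of the two absolute values is at least half of the distance between
  \<open>p\<close> and \<open>q\<close>, so its factor is at most \<open>2 powr a\<close> times the
  factor of \<open>q - p\<close>. The remaining factor is enlarged to the sum of both, which makes
  the bound symmetric.\<close>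

lemma powr_mult_powr_le_add_mult:
  fixes p q :: int and a :: real
  assumes "p \<noteq> 0" "q \<noteq> 0" "p \<noteq> q" "a > 0"
  shows "\<bar>real_of_int p\<bar> powr (- a) * \<bar>real_of_int q\<bar> powr (- a) \<le>
    2 powr a * (\<bar>real_of_int p\<bar> powr (- a) + \<bar>real_of_int q\<bar> powr (- a)) * \<bar>real_of_int (q - p)\<bar> powr (- a)"
proof -
  have *: "x powr (- a) * y powr (- a) \<le> 2 powr a * (x powr (- a) + y powr (- a)) * z powr (- a)"
    if "0 < x" "x \<le> y" "0 < z" "z \<le> x + y" for x y z :: real
  proof -
    have "y powr (- a) \<le> (z / 2) powr (- a)"
      by (rule powr_mono2') (use that assms in auto)
    also have "\<dots> = 2 powr a * z powr (- a)"
      using that by (simp add: powr_divide powr_minus divide_simps)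
    finally have "x powr (- a) * y powr (- a) \<le> x powr (- a) * (2 powr a * z powr (- a))"
      by (intro mult_left_mono) auto
    also have "\<dots> \<le> (x powr (- a) + y powr (- a)) * (2 powr a * z powr (- a))"
      by (intro mult_right_mono) auto
    finally show ?thesis
      by (simp add: mult_ac)
  qed
  have "\<bar>real_of_int (q - p)\<bar> > 0" "\<bar>real_of_int (q - p)\<bar> \<le> \<bar>real_of_int p\<bar> + \<bar>real_of_int q\<bar>"
    using assms by auto
  then show ?thesis
    using *[of "\<bar>real_of_int p\<bar>" "\<bar>real_of_int q\<bar>" "\<bar>real_of_int (q - p)\<bar>"]
      *[of "\<bar>real_of_int q\<bar>" "\<bar>real_of_int p\<bar>" "\<bar>real_of_int (q - p)\<bar>"] assms
    by (cases "\<bar>p\<bar> \<le> \<bar>q\<bar>") (auto simp: mult_ac add_ac)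
qed

lemma ipow_mult_le:
  assumes "p \<noteq> 0" "q \<noteq> 0" "p \<noteq> q" "a > 0"
  shows "ipow a p * ipow a q \<le> ennreal (2 powr a) * (ipow a p + ipow a q) * ipow a (q - p)"
  using ennreal_leI[OF powr_mult_powr_le_add_mult[OF assms]]
  by (simp add: ipow_def ennreal_mult)

text \<open>With \<open>m = g * k\<close> and at most \<open>g\<close> solutions, the left side is
  at most \<open>g powr (1 - a)\<close> times the factor of \<open>k\<close>, and
  \<open>g powr (1 - a) <= 1\<close> because \<open>a > 1\<close>. The loss from a non-prime modulus
  is thus absorbed by the decay.\<close>

lemma card_mult_ipow_le:
  fixes c m :: int
  assumes n: "n \<ge> 2" and a: "a > 1" and m: "m \<noteq> 0"
  defines "g \<equiv> gcd c (int n)"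
  shows "of_nat (card {y \<in> Un_set n. [m * y + c = 0] (mod int n)}) * ipow a m
    \<le> (if g dvd m then ipow a (m div g) else 0)"
proof (cases "g dvd m")
  case False
  then show ?thesis
    using card_Un_set_solutions_le[OF n, of m c] by (simp add: g_def)
next
  case True
  let ?N = "card {y \<in> Un_set n. [m * y + c = 0] (mod int n)}"
  have g: "g \<ge> 1" using n by (simp add: g_def int_one_le_iff_zero_less)
  obtain k where k: "m = g * k" using True by blast
  then have "k \<noteq> 0" using m by auto
  have N: "real ?N \<le> real_of_int g"
    using card_Un_set_solutions_le[OF n, of m c] True
    by (simp add: g_def)
  have "real ?N * real_of_int \<bar>m\<bar> powr (- a) \<le> real_of_int g * real_of_int \<bar>m\<bar> powr (- a)"
    by (intro mult_right_mono N) auto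
  also have "\<dots> = real_of_int g powr (1 - a) * real_of_int \<bar>k\<bar> powr (- a)"
    using g by (simp add: k abs_mult powr_mult powr_diff powr_minus divide_simps)
  also have "\<dots> \<le> 1 * real_of_int \<bar>k\<bar> powr (- a)"
    using g a powr_mono[of "1 - a" 0 "real_of_int g"] by (intro mult_right_mono) auto
  finally have "ennreal (real ?N * real_of_int \<bar>m\<bar> powr (- a)) \<le> ennreal (real_of_int \<bar>k\<bar> powr (- a))"
    by (intro ennreal_leI) simp
  then show ?thesis
    using True k g by (simp add: ipow_def ennreal_mult ennreal_of_nat_eq_real_of_nat)
qed

text \<open>
  Here \<open>p\<close> and \<open>q\<close> are the \<open>s\<close>-th coordinates of \<open>h\<close> and \<open>h + l\<close>; \<open>A0\<close>, \<open>A1\<close> (and \<open>B0\<close>, \<open>B1\<close>) stand for the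
  contribution of the other coordinates when \<open>s\<close> is outside, respectively inside, the support.
\<close>
lemma infsum_two_coordinates_le:
  fixes A0 A1 B0 B1 :: ennreal and c :: int
  assumes n: "n \<ge> 2" and a: "a > 1"
  defines "C \<equiv> \<Sum>\<^sub>\<infinity>k\<in>-{0}. ipow a k"
  shows "(\<Sum>\<^sub>\<infinity>p. \<Sum>\<^sub>\<infinity>q\<in>-{p}. of_nat (card {y \<in> Un_set n. [(q - p) * y + c = 0] (mod int n)}) *
      ((if p = 0 then A0 else A1 * ipow a p) * (if q = 0 then B0 else B1 * ipow a q)))
    \<le> A0 * (B1 * C) + (A1 * C) * B0 + ennreal (2 powr (a + 1)) * ((A1 * C) * (B1 * C))"
    (is "(\<Sum>\<^sub>\<infinity>p. \<Sum>\<^sub>\<infinity>q\<in>-{p}. ?f p q) \<le> _")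
proof -
  define g where "g = gcd c (int n)"
  define D where "D m = (if g dvd m then ipow a (m div g) else 0)" for m
  define N where "N m = (of_nat (card {y \<in> Un_set n. [m * y + c = 0] (mod int n)}) :: ennreal)" for m
  have g: "g > 0" using n by (simp add: g_def)
  have N: "N m * ipow a m \<le> D m" if "m \<noteq> 0" for m
    unfolding N_def D_def g_def using card_mult_ipow_le[OF n a that] .
  \<comment> \<open>\<open>D\<close> vanishes off the multiples of \<open>g\<close>, and
    \<open>m div g\<close> embeds the nonzero multiples into the nonzero integers. The bound
    \<open>C\<close> no longer depends on \<open>c\<close>.\<close>
  have D: "(\<Sum>\<^sub>\<infinity>m\<in>-{0}. D m) \<le> C"
  proof -
    have "(\<Sum>\<^sub>\<infinity>m\<in>-{0}. D m) = (\<Sum>\<^sub>\<infinity>m\<in>{m. m \<noteq> 0 \<and> g dvd m}. D m)"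
      by (rule infsum_cong_neutral) (auto simp: D_def)
    also have "\<dots> \<le> C"
      unfolding C_def
      by (rule infsum_ennreal_inj_le[of "\<lambda>m. m div g"]) (use g in \<open>auto simp: D_def inj_on_def\<close>)
    finally show ?thesis .
  qed
  \<comment> \<open>The terms are split into three families: \<open>p = 0\<close>, then
    \<open>q = 0\<close>, then both nonzero. In the first two families, the difference
    \<open>q - p\<close> is up to sign the only nonzero variable, so \<open>D\<close> alone bounds
    the sum.\<close>
  have "(\<Sum>\<^sub>\<infinity>q\<in>-{0}. ?f 0 q) \<le> (\<Sum>\<^sub>\<infinity>q\<in>-{0}. (A0 * B1) * D q)"
  proof (rule infsum_ennreal_mono)
    fix q :: int assume q: "q \<in> - {0}"
    have "?f 0 q = (A0 * B1) * (N q * ipow a q)"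
      using q by (simp add: N_def mult_ac)
    also have "\<dots> \<le> (A0 * B1) * D q"
      by (intro mult_left_mono N) (use q in auto)
    finally show "?f 0 q \<le> (A0 * B1) * D q" .
  qed
  also have "\<dots> \<le> (A0 * B1) * C"
    unfolding infsum_ennreal_cmult by (intro mult_left_mono D) auto
  finally have 1: "(\<Sum>\<^sub>\<infinity>q\<in>-{0}. ?f 0 q) \<le> A0 * (B1 * C)"
    by (simp add: mult_ac)

  have "(\<Sum>\<^sub>\<infinity>p\<in>-{0}. ?f p 0) \<le> (\<Sum>\<^sub>\<infinity>p\<in>-{0}. (A1 * B0) * D (- p))"
  proof (rule infsum_ennreal_mono)
    fix p :: int assume p: "p \<in> - {0}"
    have "?f p 0 = (A1 * B0) * (N (- p) * ipow a (- p))"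
      using p by (simp add: N_def mult_ac)
    also have "\<dots> \<le> (A1 * B0) * D (- p)"
      by (intro mult_left_mono N) (use p in auto)
    finally show "?f p 0 \<le> (A1 * B0) * D (- p)" .
  qed
  also have "\<dots> = (A1 * B0) * (\<Sum>\<^sub>\<infinity>p\<in>-{0}. D (- p))"
    by (rule infsum_ennreal_cmult)
  also have "(\<Sum>\<^sub>\<infinity>p\<in>-{0}. D (- p)) = (\<Sum>\<^sub>\<infinity>p\<in>-{0}. D p)"
    by (rule infsum_reindex_bij_witness[of _ uminus uminus]) auto
  also have "(A1 * B0) * \<dots> \<le> (A1 * B0) * C"
    by (intro mult_left_mono D) auto
  finally have 2: "(\<Sum>\<^sub>\<infinity>p\<in>-{0}. ?f p 0) \<le> (A1 * C) * B0"
    by (simp add: mult_ac)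

  let ?K = "ennreal (2 powr a)"
  \<comment> \<open>With both entries nonzero, part of the decay is traded for decay in
    \<open>q - p\<close>, which is needed to absorb the number of solutions. What is left is decay
    in \<open>p\<close> or in \<open>q\<close>.\<close>
  have "(\<Sum>\<^sub>\<infinity>p\<in>-{0}. \<Sum>\<^sub>\<infinity>q\<in>-{0,p}. ?f p q)
    \<le> (\<Sum>\<^sub>\<infinity>p\<in>-{0}. \<Sum>\<^sub>\<infinity>q\<in>-{0,p}. (A1 * B1 * ?K) * (ipow a p * D (q - p) + ipow a q * D (q - p)))"
  proof (intro infsum_ennreal_mono)
    fix p q :: int assume pq: "p \<in> - {0}" "q \<in> - {0, p}"
    have "?f p q = (A1 * B1) * N (q - p) * (ipow a p * ipow a q)"
      using pq by (simp add: N_def mult_ac)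
    also have "\<dots> \<le> (A1 * B1) * N (q - p) * (?K * (ipow a p + ipow a q) * ipow a (q - p))"
      by (intro mult_left_mono ipow_mult_le) (use pq a in auto)
    also have "\<dots> = (A1 * B1 * ?K) * (ipow a p + ipow a q) * (N (q - p) * ipow a (q - p))"
      by (simp add: mult_ac)
    also have "\<dots> \<le> (A1 * B1 * ?K) * (ipow a p + ipow a q) * D (q - p)"
      by (intro mult_left_mono N) (use pq in auto)
    also have "\<dots> = (A1 * B1 * ?K) * (ipow a p * D (q - p) + ipow a q * D (q - p))"
      by (simp add: algebra_simps)
    finally show "?f p q \<le> (A1 * B1 * ?K) * (ipow a p * D (q - p) + ipow a q * D (q - p))" .
  qed
  also have "\<dots> = (A1 * B1 * ?K) * ((\<Sum>\<^sub>\<infinity>p\<in>-{0}. \<Sum>\<^sub>\<infinity>q\<in>-{0,p}. ipow a p * D (q - p))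
      + (\<Sum>\<^sub>\<infinity>p\<in>-{0}. \<Sum>\<^sub>\<infinity>q\<in>-{0,p}. ipow a q * D (q - p)))"
    by (simp only: infsum_ennreal_cmult infsum_ennreal_add)
  also have "\<dots> \<le> (A1 * B1 * ?K) * (C * C + C * C)"
  proof (intro mult_left_mono add_mono)
    have le: "(\<Sum>\<^sub>\<infinity>p\<in>-{0}. \<Sum>\<^sub>\<infinity>m\<in>-{0}. ipow a p * D m) \<le> C * C"
      unfolding infsum_ennreal_product using D by (auto simp: C_def intro: mult_left_mono)
    \<comment> \<open>The difference becomes an independent nonzero variable, paired with
      \<open>p\<close> here and with \<open>q\<close> below; the condition on the other entry is
      dropped. The two halves together account for the exponent \<open>a + 1\<close> of 2.\<close>
    show "(\<Sum>\<^sub>\<infinity>p\<in>-{0}. \<Sum>\<^sub>\<infinity>q\<in>-{0,p}. ipow a p * D (q - p)) \<le> C * C"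
      by (rule order_trans[OF _ le], unfold infsum_ennreal_Sigma,
          rule infsum_ennreal_inj_le[of "\<lambda>(p, q). (p, q - p)"]) (auto simp: inj_on_def)
    show "(\<Sum>\<^sub>\<infinity>p\<in>-{0}. \<Sum>\<^sub>\<infinity>q\<in>-{0,p}. ipow a q * D (q - p)) \<le> C * C"
      by (rule order_trans[OF _ le], unfold infsum_ennreal_Sigma,
          rule infsum_ennreal_inj_le[of "\<lambda>(p, q). (q, q - p)"]) (auto simp: inj_on_def)
  qed auto
  also have "\<dots> = (?K * 2) * ((A1 * C) * (B1 * C))"
    unfolding mult_2[symmetric] by (simp add: mult_ac)
  also have "?K * 2 = ennreal (2 powr (a + 1))"
    by (simp add: powr_add ennreal_mult)
  finally have 3: "(\<Sum>\<^sub>\<infinity>p\<in>-{0}. \<Sum>\<^sub>\<infinity>q\<in>-{0,p}. ?f p q)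
    \<le> ennreal (2 powr (a + 1)) * ((A1 * C) * (B1 * C))" .

  have ins: "infsum h (insert 0 X) = h 0 + infsum h X" if "0 \<notin> X" for h :: "int \<Rightarrow> ennreal" and X
    using that by (intro infsum_insert) (auto intro: nonneg_summable_on_complete)
  have U: "UNIV = insert 0 (- {0::int})"
    by auto
  have "(\<Sum>\<^sub>\<infinity>p. \<Sum>\<^sub>\<infinity>q\<in>-{p}. ?f p q)
      = (\<Sum>\<^sub>\<infinity>q\<in>-{0}. ?f 0 q) + (\<Sum>\<^sub>\<infinity>p\<in>-{0}. \<Sum>\<^sub>\<infinity>q\<in>-{p}. ?f p q)"
    unfolding U by (rule ins) auto
  also have "(\<Sum>\<^sub>\<infinity>p\<in>-{0}. \<Sum>\<^sub>\<infinity>q\<in>-{p}. ?f p q)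
      = (\<Sum>\<^sub>\<infinity>p\<in>-{0}. ?f p 0 + (\<Sum>\<^sub>\<infinity>q\<in>-{0,p}. ?f p q))"
  proof (rule infsum_cong)
    fix p :: int assume "p \<in> - {0}"
    then have "- {p} = insert 0 (- {0, p})"
      by auto
    then show "(\<Sum>\<^sub>\<infinity>q\<in>-{p}. ?f p q) = ?f p 0 + (\<Sum>\<^sub>\<infinity>q\<in>-{0,p}. ?f p q)"
      by (simp only:) (rule ins, auto)
  qed
  also have "\<dots> = (\<Sum>\<^sub>\<infinity>p\<in>-{0}. ?f p 0) + (\<Sum>\<^sub>\<infinity>p\<in>-{0}. \<Sum>\<^sub>\<infinity>q\<in>-{0,p}. ?f p q)"
    by (rule infsum_ennreal_add)
  finally show ?thesis
    using add_mono[OF 1 add_mono[OF 2 3]] by (simp only: add.assoc)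
qed

section \<open>The error and the CBC criterion as double sums\<close>

text \<open>This is the reciprocal of \<open>rfun\<close>, with the weight kept apart from the
  product over coordinates.\<close>

definition wterm :: "(nat set \<Rightarrow> real) \<Rightarrow> real \<Rightarrow> (nat \<Rightarrow> int) \<Rightarrow> ennreal" where
  "wterm \<gamma> a h = ennreal (\<gamma> (supp h)) * (\<Prod>j\<in>supp h. ipow a (h j))"

text \<open>The share of the error that comes from those \<open>l\<close> whose last nonzero
  coordinate is \<open>s\<close>. Here \<open>h\<close> keeps all \<open>d\<close> coordinates,
  unlike in \<open>theta\<close>. Weights and exponent are free so that the powers by
  \<open>lam\<close> fit the same shape.\<close>

definition pair_sum :: "nat \<Rightarrow> nat \<Rightarrow> nat \<Rightarrow> real \<Rightarrow> (nat set \<Rightarrow> real) \<Rightarrow> (nat \<Rightarrow> int) \<Rightarrow> ennreal" where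
  "pair_sum n d s a \<gamma> z =
     (\<Sum>\<^sub>\<infinity>h\<in>vecs d. \<Sum>\<^sub>\<infinity>l\<in>{l \<in> vecs s. l s \<noteq> 0 \<and> [dotp s l z = 0] (mod int n)}.
        wterm \<gamma> a h * wterm \<gamma> a (\<lambda>j. h j + l j))"

lemma vecs_eq_supp: "vecs d = {h. supp h \<subseteq> {1..d}}"
  by (auto simp: vecs_def supp_def)

lemma ennreal_divide_rprime:
  "ennreal (x / rprime a h) = ennreal x * (\<Prod>j\<in>supp h. ipow a (h j))"
proof -
  have "1 / rprime a h = (\<Prod>j\<in>supp h. real_of_int \<bar>h j\<bar> powr (- a))"
    by (simp add: rprime_def powr_minus divide_inverse prod_inversef[symmetric] o_def)
  then have "x / rprime a h = x * (\<Prod>j\<in>supp h. real_of_int \<bar>h j\<bar> powr (- a))"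
    by (simp add: divide_inverse)
  then show ?thesis
    by (simp add: ipow_def prod_ennreal ennreal_mult'' prod_nonneg)
qed

text \<open>The index \<open>s\<close> is the maximum of the support of \<open>l\<close>.
  Coordinates beyond it contribute nothing, so \<open>dotp d\<close> and \<open>dotp s\<close> agree
  on \<open>l\<close>.\<close>

lemma vecs_nonzero_decompose:
  "{l \<in> vecs d. l \<noteq> (\<lambda>_. 0) \<and> [dotp d l z = 0] (mod int n)}
    = (\<Union>s\<in>{1..d}. {l \<in> vecs s. l s \<noteq> 0 \<and> [dotp s l z = 0] (mod int n)})"
proof -
  have dotp: "dotp d l z = dotp s l z" if "l \<in> vecs s" "s \<le> d" for s l
    unfolding dotp_def by (rule sum.mono_neutral_right) (use that in \<open>auto simp: vecs_def\<close>)
  have 1: "\<exists>s\<in>{1..d}. l \<in> vecs s \<and> l s \<noteq> 0" if l: "l \<in> vecs d" "l \<noteq> (\<lambda>_. 0)" for l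
  proof (intro bexI conjI)
    let ?s = "Max (supp l)"
    have fin: "finite (supp l)"
      using l by (auto simp: vecs_eq_supp intro: finite_subset)
    have "supp l \<noteq> {}"
      using l by (simp add: supp_eq_empty_iff)
    with fin have s: "?s \<in> supp l"
      by (rule Max_in)
    then show "l ?s \<noteq> 0" "?s \<in> {1..d}"
      using l by (auto simp: vecs_eq_supp supp_def)
    show "l \<in> vecs ?s"
      using l fin by (auto simp: vecs_eq_supp)
  qed
  have 2: "l \<in> vecs d \<and> l \<noteq> (\<lambda>_. 0)" if "l \<in> vecs s" "l s \<noteq> 0" "s \<in> {1..d}" for l s
    using that by (auto simp: vecs_def)
  show ?thesis
  proof (intro equalityI subsetI)
    fix l assume l: "l \<in> {l \<in> vecs d. l \<noteq> (\<lambda>_. 0) \<and> [dotp d l z = 0] (mod int n)}"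
    then obtain s where s: "s \<in> {1..d}" "l \<in> vecs s" "l s \<noteq> 0"
      using 1 by blast
    then have "dotp d l z = dotp s l z"
      by (intro dotp) auto
    with l s show "l \<in> (\<Union>s\<in>{1..d}. {l \<in> vecs s. l s \<noteq> 0 \<and> [dotp s l z = 0] (mod int n)})"
      by auto
  next
    fix l assume "l \<in> (\<Union>s\<in>{1..d}. {l \<in> vecs s. l s \<noteq> 0 \<and> [dotp s l z = 0] (mod int n)})"
    then obtain s where s: "s \<in> {1..d}" "l \<in> vecs s" "l s \<noteq> 0" "[dotp s l z = 0] (mod int n)"
      by blast
    then have "dotp d l z = dotp s l z"
      by (intro dotp) auto
    with 2[OF s(2,3,1)] s(4) show "l \<in> {l \<in> vecs d. l \<noteq> (\<lambda>_. 0) \<and> [dotp d l z = 0] (mod int n)}"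
      by simp
  qed
qed

lemma S_err_eq_sum_pair_sum: "S_err n d \<alpha> \<gamma> z = (\<Sum>s\<in>{1..d}. pair_sum n d s \<alpha> \<gamma> z)"
proof -
  let ?L = "\<lambda>s. {l \<in> vecs s. l s \<noteq> 0 \<and> [dotp s l z = 0] (mod int n)}"
  have disj: "disjoint_family_on ?L {1..d}"
    unfolding disjoint_family_on_def
  proof (intro ballI impI)
    fix s t :: nat assume "s \<noteq> t"
    then show "?L s \<inter> ?L t = {}"
      by (cases "s < t") (auto simp: vecs_def)
  qed
  have "S_err n d \<alpha> \<gamma> z
      = (\<Sum>\<^sub>\<infinity>h\<in>vecs d. wterm \<gamma> \<alpha> h * (\<Sum>\<^sub>\<infinity>l\<in>(\<Union>s\<in>{1..d}. ?L s). wterm \<gamma> \<alpha> (\<lambda>j. h j + l j)))"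
    unfolding S_err_def rfun_def vecs_nonzero_decompose by (simp add: ennreal_divide_rprime wterm_def)
  also have "\<dots> = (\<Sum>\<^sub>\<infinity>h\<in>vecs d. \<Sum>s\<in>{1..d}. \<Sum>\<^sub>\<infinity>l\<in>?L s. wterm \<gamma> \<alpha> h * wterm \<gamma> \<alpha> (\<lambda>j. h j + l j))"
    by (subst infsum_ennreal_UN_disjoint[OF _ disj])
      (simp_all add: sum_distrib_left infsum_ennreal_cmult)
  also have "\<dots> = (\<Sum>s\<in>{1..d}. pair_sum n d s \<alpha> \<gamma> z)"
    unfolding pair_sum_def by (rule infsum_ennreal_sum) simp
  finally show ?thesis .
qed

section \<open>Splitting a vector into its coordinates up to \<open>s\<close> and beyond
  \<open>s\<close>\<close>

lemma supp_add_disjoint: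
  assumes "supp h \<inter> supp k = {}"
  shows "supp (\<lambda>j. h j + k j) = supp h \<union> supp k"
proof -
  have "h j = 0 \<or> k j = 0" for j
    using assms by (auto simp: supp_def)
  then have "h j + k j \<noteq> 0 \<longleftrightarrow> h j \<noteq> 0 \<or> k j \<noteq> 0" for j
    by (metis add.left_neutral add.right_neutral)
  then show ?thesis
    unfolding supp_def by (simp only: Collect_disj_eq)
qed

lemma prod_supp_add_disjoint:
  fixes f :: "int \<Rightarrow> 'a :: comm_monoid_mult"
  assumes "supp h \<inter> supp k = {}" "finite (supp h)" "finite (supp k)"
  shows "(\<Prod>j\<in>supp (\<lambda>j. h j + k j). f (h j + k j)) = (\<Prod>j\<in>supp h. f (h j)) * (\<Prod>j\<in>supp k. f (k j))"
proof -
  have h: "h j = 0" if "j \<in> supp k" for j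
    using assms that by (auto simp: supp_def)
  have k: "k j = 0" if "j \<in> supp h" for j
    using assms that by (auto simp: supp_def)
  have "(\<Prod>j\<in>supp (\<lambda>j. h j + k j). f (h j + k j))
      = (\<Prod>j\<in>supp h. f (h j + k j)) * (\<Prod>j\<in>supp k. f (h j + k j))"
    unfolding supp_add_disjoint[OF assms(1)] by (rule prod.union_disjoint) (use assms in auto)
  also have "(\<Prod>j\<in>supp h. f (h j + k j)) = (\<Prod>j\<in>supp h. f (h j))"
    by (rule prod.cong) (use h k in auto)
  also have "(\<Prod>j\<in>supp k. f (h j + k j)) = (\<Prod>j\<in>supp k. f (k j))"
    by (rule prod.cong) (use h k in auto)
  finally show ?thesis .
qed

lemma ipow_mult_self: "ipow a k * ipow a k = ipow (2 * a) k"
  by (simp add: ipow_def flip: ennreal_mult powr_add)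

text \<open>As \<open>l\<close> vanishes beyond \<open>s\<close>, the vectors \<open>h\<close> and
  \<open>h + l\<close> share the same tail \<open>k\<close>. Its factors occur twice, which doubles
  the exponent to \<open>2 * \<alpha>\<close>; summing over tails with support \<open>w\<close>
  gives \<open>2 * zeta (2 * \<alpha>)\<close> to the power \<open>card w\<close>.\<close>

lemma T_crit_eq_pair_sum:
  assumes "\<alpha> > 1" "s \<le> d"
  shows "T_crit n d s \<alpha> \<gamma> z = pair_sum n d s \<alpha> \<gamma> z"
proof -
  let ?L = "{l \<in> vecs s. l s \<noteq> 0 \<and> [dotp s l z = 0] (mod int n)}"
  let ?V = "{k. supp k \<subseteq> {s+1..d}}"
  let ?\<gamma> = "\<lambda>k u. \<gamma> (u \<union> supp k)"
  have wt: "wterm \<gamma> \<alpha> (\<lambda>j. h j + k j) = wterm (?\<gamma> k) \<alpha> h * (\<Prod>j\<in>supp k. ipow \<alpha> (k j))"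
    if "h \<in> vecs s" "k \<in> ?V" for h k
  proof -
    have sub: "supp h \<subseteq> {1..s}" "supp k \<subseteq> {s+1..d}"
      using that by (auto simp: vecs_eq_supp)
    then have "finite (supp h)" "finite (supp k)"
      by (auto intro: finite_subset)
    moreover have "{1..s} \<inter> {s+1..d} = {}"
      by auto
    then have "supp h \<inter> supp k = {}"
      using sub by blast
    ultimately show ?thesis
      unfolding wterm_def by (subst prod_supp_add_disjoint) (simp_all add: supp_add_disjoint mult_ac)
  qed
  have "pair_sum n d s \<alpha> \<gamma> z = (\<Sum>\<^sub>\<infinity>(k, h)\<in>?V \<times> vecs s. \<Sum>\<^sub>\<infinity>l\<in>?L.
      wterm \<gamma> \<alpha> (\<lambda>j. h j + k j) * wterm \<gamma> \<alpha> (\<lambda>j. (h j + k j) + l j))"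
    unfolding pair_sum_def
  proof (rule infsum_reindex_bij_witness[of _ "\<lambda>(k, h) j. h j + k j"
          "\<lambda>h. (\<lambda>j. if j \<le> s then 0 else h j, \<lambda>j. if j \<le> s then h j else 0)"])
    have split: "(\<lambda>j. (if j \<le> s then h j else 0) + (if j \<le> s then 0 else h j)) = h" for h :: "nat \<Rightarrow> int"
      by auto
    fix h :: "nat \<Rightarrow> int" assume h: "h \<in> vecs d"
    let ?kh = "(\<lambda>j. if j \<le> s then 0 else h j, \<lambda>j. if j \<le> s then h j else 0)"
    show "(case ?kh of (k, h) \<Rightarrow> \<lambda>j. h j + k j) = h"
      by (simp add: split)
    have "h j = 0" if "j > d \<or> j = 0" for j
      using h that by (auto simp: vecs_def)
    then show "?kh \<in> ?V \<times> vecs s"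
      by (force simp: supp_def vecs_def not_le)
    have *: "(if j \<le> s then h j else 0) + (if j \<le> s then 0 else h j) = h j" for j
      by simp
    show "(case ?kh of (k, h) \<Rightarrow> \<Sum>\<^sub>\<infinity>l\<in>?L.
        wterm \<gamma> \<alpha> (\<lambda>j. h j + k j) * wterm \<gamma> \<alpha> (\<lambda>j. (h j + k j) + l j))
      = (\<Sum>\<^sub>\<infinity>l\<in>?L. wterm \<gamma> \<alpha> h * wterm \<gamma> \<alpha> (\<lambda>j. h j + l j))"
      by (simp only: prod.case *)
  next
    fix x assume "x \<in> ?V \<times> vecs s"
    then obtain k h where x: "x = (k, h)" and k: "supp k \<subseteq> {s+1..d}" and h: "h \<in> vecs s"
      by auto
    have k0: "k j = 0" if "j \<notin> {s+1..d}" for j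
      using k that unfolding supp_def by blast
    have h0: "h j = 0" if "j > s \<or> j = 0" for j
      using h that by (auto simp: vecs_def)
    show "(case x of (k, h) \<Rightarrow> \<lambda>j. h j + k j) \<in> vecs d"
      using k0 h0 assms(2) by (auto simp: x vecs_def)
    have "(\<lambda>j. if j \<le> s then 0 else h j + k j) = k" "(\<lambda>j. if j \<le> s then h j + k j else 0) = h"
      using k0 h0 by (auto simp: fun_eq_iff)
    then show "(\<lambda>j. if j \<le> s then 0 else (case x of (k, h) \<Rightarrow> \<lambda>j. h j + k j) j,
        \<lambda>j. if j \<le> s then (case x of (k, h) \<Rightarrow> \<lambda>j. h j + k j) j else 0) = x"
      unfolding x prod.case by simp
  qed
  also have "\<dots> = (\<Sum>\<^sub>\<infinity>k\<in>?V. \<Sum>\<^sub>\<infinity>h\<in>vecs s. \<Sum>\<^sub>\<infinity>l\<in>?L.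
      wterm \<gamma> \<alpha> (\<lambda>j. h j + k j) * wterm \<gamma> \<alpha> (\<lambda>j. (h j + k j) + l j))"
    by (rule infsum_ennreal_Sigma[symmetric])
  also have "\<dots> = (\<Sum>\<^sub>\<infinity>k\<in>?V. \<Sum>\<^sub>\<infinity>h\<in>vecs s. \<Sum>\<^sub>\<infinity>l\<in>?L.
      (wterm (?\<gamma> k) \<alpha> h * wterm (?\<gamma> k) \<alpha> (\<lambda>j. h j + l j)) * (\<Prod>j\<in>supp k. ipow (2 * \<alpha>) (k j)))"
  proof (intro infsum_cong)
    fix k h l assume k: "k \<in> ?V" and h: "h \<in> vecs s" and l: "l \<in> ?L"
    have hl: "(\<lambda>j. h j + l j) \<in> vecs s"
      using h l by (auto simp: vecs_def)
    show "wterm \<gamma> \<alpha> (\<lambda>j. h j + k j) * wterm \<gamma> \<alpha> (\<lambda>j. (h j + k j) + l j)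
      = (wterm (?\<gamma> k) \<alpha> h * wterm (?\<gamma> k) \<alpha> (\<lambda>j. h j + l j)) * (\<Prod>j\<in>supp k. ipow (2 * \<alpha>) (k j))"
      using wt[OF h k] wt[OF hl k]
      unfolding ipow_mult_self[symmetric] prod.distrib by (simp add: mult_ac add_ac)
  qed
  also have "\<dots> = (\<Sum>\<^sub>\<infinity>k\<in>?V. theta n s \<alpha> z (\<lambda>u. \<gamma> (u \<union> supp k)) * (\<Prod>j\<in>supp k. ipow (2 * \<alpha>) (k j)))"
    by (simp add: theta_def ennreal_divide_rprime wterm_def infsum_ennreal_cmult_right)
  also have "\<dots> = (\<Sum>w\<in>Pow {s+1..d}. theta n s \<alpha> z (\<lambda>u. \<gamma> (u \<union> w)) * (\<Sum>\<^sub>\<infinity>k\<in>-{0}. ipow (2 * \<alpha>) k) ^ card w)"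
    by (rule infsum_prod_supp_subset) simp
  also have "\<dots> = T_crit n d s \<alpha> \<gamma> z"
    using assms zeta_pos[of "2 * \<alpha>"]
    by (simp add: T_crit_def infsum_ipow ennreal_power mult.commute)
  finally show ?thesis ..
qed

section \<open>Averaging over the candidates for one component\<close>

lemma wterm_fun_upd:
  assumes "s \<notin> supp u" "finite (supp u)"
  shows "wterm \<gamma> a (u(s := p)) = (if p = 0 then wterm \<gamma> a u
    else wterm (\<lambda>w. \<gamma> (insert s w)) a u * ipow a p)"
proof (cases "p = 0")
  case True
  then have "u(s := p) = u"
    using assms by (auto simp: supp_def)
  with True show ?thesis by simp
next
  case False
  then have "supp (u(s := p)) = insert s (supp u)"
    by (auto simp: supp_def)
  moreover have "(\<Prod>j\<in>supp u. ipow a ((u(s := p)) j)) = (\<Prod>j\<in>supp u. ipow a (u j))"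
    by (rule prod.cong) (use assms in auto)
  ultimately show ?thesis
    using False assms by (simp add: wterm_def mult_ac)
qed

text \<open>\<open>u\<close> and \<open>v\<close> are \<open>h\<close> and \<open>h + l\<close> with
  the entry at \<open>s\<close> cleared, while \<open>p\<close> and \<open>q\<close> are the cleared
  entries; \<open>l s\<close> nonzero becomes \<open>q\<close> different from \<open>p\<close>. The
  inequality arises because \<open>u\<close> and \<open>v\<close> are no longer required to agree
  beyond \<open>s\<close>.\<close>

lemma pair_sum_le_separated:
  assumes s: "s \<in> {1..d}"
  defines "V \<equiv> {u. supp u \<subseteq> {1..d} - {s}}"
  shows "pair_sum n d s a \<gamma> z \<le> (\<Sum>\<^sub>\<infinity>((u, v), p, q)\<in>(V \<times> V) \<times> (SIGMA p:UNIV. -{p}).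
    (if [(q - p) * z s + (\<Sum>j\<in>{1..<s}. (v j - u j) * z j) = 0] (mod int n) then 1 else 0) *
    (wterm \<gamma> a (u(s := p)) * wterm \<gamma> a (v(s := q))))"
  unfolding pair_sum_def infsum_ennreal_Sigma
proof (rule infsum_ennreal_inj_le[of "\<lambda>(h, l). ((h(s := 0), \<lambda>j. if j = s then 0 else h j + l j), h s, h s + l s)"])
  let ?L = "{l \<in> vecs s. l s \<noteq> 0 \<and> [dotp s l z = 0] (mod int n)}"
  show "inj_on (\<lambda>(h, l). ((h(s := 0), \<lambda>j. if j = s then 0 else h j + l j), h s, h s + l s)) (vecs d \<times> ?L)"
  proof (rule inj_onI, clarify)
    fix h l h' l' :: "nat \<Rightarrow> int"
    assume eq: "h(s := 0) = h'(s := 0)" "(\<lambda>j. if j = s then 0 else h j + l j) = (\<lambda>j. if j = s then 0 else h' j + l' j)"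
      "h s = h' s" "h s + l s = h' s + l' s"
    have h: "h j = h' j" for j
      using fun_cong[OF eq(1), of j] eq(3) by (cases "j = s") auto
    have "l j = l' j" for j
      using fun_cong[OF eq(2), of j] eq(4) h by (cases "j = s") auto
    with h show "h = h' \<and> l = l'" by auto
  qed
  show "(\<lambda>(h, l). ((h(s := 0), \<lambda>j. if j = s then 0 else h j + l j), h s, h s + l s)) ` (vecs d \<times> ?L)
      \<subseteq> (V \<times> V) \<times> (SIGMA p:UNIV. -{p})"
  proof (rule image_subsetI)
    fix x assume "x \<in> vecs d \<times> ?L"
    then obtain h l where x: "x = (h, l)" and h: "h \<in> vecs d" and l: "l \<in> vecs s" "l s \<noteq> 0"
      by auto
    have "j \<in> {1..d}" if "h j \<noteq> 0 \<or> h j + l j \<noteq> 0" for j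
    proof (rule ccontr)
      assume "j \<notin> {1..d}"
      then have "h j = 0" "l j = 0"
        using h l s by (auto simp: vecs_def)
      with that show False by simp
    qed
    then have "supp (h(s := 0)) \<subseteq> {1..d} - {s}" "supp (\<lambda>j. if j = s then 0 else h j + l j) \<subseteq> {1..d} - {s}"
      unfolding supp_def by (auto simp del: atLeastAtMost_iff split: if_splits)
    then show "(case x of (h, l) \<Rightarrow> ((h(s := 0), \<lambda>j. if j = s then 0 else h j + l j), h s, h s + l s))
        \<in> (V \<times> V) \<times> (SIGMA p:UNIV. -{p})"
      using l by (simp add: x V_def)
  qed
next
  fix x assume "x \<in> vecs d \<times> {l \<in> vecs s. l s \<noteq> 0 \<and> [dotp s l z = 0] (mod int n)}"
  then obtain h l where x: "x = (h, l)" and l: "[dotp s l z = 0] (mod int n)"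
    by auto
  have "{1..s} = insert s {1..<s}"
    using s by auto
  then have "dotp s l z = l s * z s + (\<Sum>j\<in>{1..<s}. l j * z j)"
    by (simp add: dotp_def)
  also have "(\<Sum>j\<in>{1..<s}. l j * z j) = (\<Sum>j\<in>{1..<s}. ((if j = s then 0 else h j + l j) - (h(s := 0)) j) * z j)"
    by (rule sum.cong) auto
  finally have "[(h s + l s - h s) * z s
      + (\<Sum>j\<in>{1..<s}. ((if j = s then 0 else h j + l j) - (h(s := 0)) j) * z j) = 0] (mod int n)"
    using l by simp
  moreover have "(\<lambda>j. if j = s then 0 else h j + l j)(s := h s + l s) = (\<lambda>j. h j + l j)"
    by auto
  ultimately show "(case x of (h, l) \<Rightarrow> wterm \<gamma> a h * wterm \<gamma> a (\<lambda>j. h j + l j))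
    \<le> (\<lambda>((u, v), p, q).
        (if [(q - p) * z s + (\<Sum>j\<in>{1..<s}. (v j - u j) * z j) = 0] (mod int n) then 1 else 0) *
        (wterm \<gamma> a (u(s := p)) * wterm \<gamma> a (v(s := q))))
      (case x of (h, l) \<Rightarrow> ((h(s := 0), \<lambda>j. if j = s then 0 else h j + l j), h s, h s + l s))"
    by (simp only: x prod.case if_True fun_upd_upd fun_upd_triv mult_1 order_refl)
qed

text \<open>Summing the indicator of the congruence over \<open>y\<close> counts its solutions. The
  bound for the two entries at \<open>s\<close> holds for every shift, so the sums over
  \<open>u\<close> and \<open>v\<close> factorise: \<open>P\<close> collects the supports without
  \<open>s\<close>, and \<open>Q\<close> those with \<open>s\<close>.\<close>

lemma sum_pair_sum_le:
  fixes \<gamma> :: "nat set \<Rightarrow> real"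
  assumes n: "n \<ge> 2" and a: "a > 1" and s: "s \<in> {1..d}"
  defines "C \<equiv> \<Sum>\<^sub>\<infinity>k\<in>-{0}. ipow a k"
  defines "P \<equiv> \<Sum>w\<in>Pow ({1..d} - {s}). ennreal (\<gamma> w) * C ^ card w"
  defines "Q \<equiv> \<Sum>w\<in>Pow ({1..d} - {s}). ennreal (\<gamma> (insert s w)) * C ^ Suc (card w)"
  shows "(\<Sum>y\<in>Un_set n. pair_sum n d s a \<gamma> (z(s := y))) \<le> P * Q + Q * P + ennreal (2 powr (a + 1)) * (Q * Q)"
proof -
  let ?V = "{u. supp u \<subseteq> {1..d} - {s}}"
  let ?c = "\<lambda>u v. \<Sum>j\<in>{1..<s}. (v j - u j) * z j"
  let ?w0 = "wterm \<gamma> a" and ?w1 = "wterm (\<lambda>w. \<gamma> (insert s w)) a"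
  let ?N = "\<lambda>m c. of_nat (card {y \<in> Un_set n. [m * y + c = 0] (mod int n)}) :: ennreal"
  have c: "(\<Sum>j\<in>{1..<s}. (v j - u j) * (z(s := y)) j) = ?c u v" for u v y
    by (rule sum.cong) auto
  have "(\<Sum>y\<in>Un_set n. pair_sum n d s a \<gamma> (z(s := y)))
    \<le> (\<Sum>y\<in>Un_set n. \<Sum>\<^sub>\<infinity>((u, v), p, q)\<in>(?V \<times> ?V) \<times> (SIGMA p:UNIV. -{p}).
      (if [(q - p) * y + ?c u v = 0] (mod int n) then 1 else 0) * (?w0 (u(s := p)) * ?w0 (v(s := q))))"
    using pair_sum_le_separated[OF s, of n a \<gamma>, of "z(s := y)" for y]
    by (intro sum_mono) (simp only: fun_upd_same c)
  also have "\<dots> = (\<Sum>\<^sub>\<infinity>((u, v), p, q)\<in>(?V \<times> ?V) \<times> (SIGMA p:UNIV. -{p}).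
      ?N (q - p) (?c u v) * (?w0 (u(s := p)) * ?w0 (v(s := q))))"
    unfolding infsum_ennreal_sum[OF finite_Un_set, symmetric]
    by (rule infsum_cong) (auto simp: sum_distrib_right[symmetric] sum.If_cases Int_def)
  also have "\<dots> = (\<Sum>\<^sub>\<infinity>u\<in>?V. \<Sum>\<^sub>\<infinity>v\<in>?V. \<Sum>\<^sub>\<infinity>p. \<Sum>\<^sub>\<infinity>q\<in>-{p}.
      ?N (q - p) (?c u v) * (?w0 (u(s := p)) * ?w0 (v(s := q))))"
    unfolding infsum_ennreal_Sigma
    by (rule infsum_reindex_bij_witness[of _ "\<lambda>(u, v, pq). ((u, v), pq)" "\<lambda>((u, v), pq). (u, v, pq)"]) auto
  also have "\<dots> \<le> (\<Sum>\<^sub>\<infinity>u\<in>?V. \<Sum>\<^sub>\<infinity>v\<in>?V.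
      ?w0 u * (?w1 v * C) + (?w1 u * C) * ?w0 v + ennreal (2 powr (a + 1)) * ((?w1 u * C) * (?w1 v * C)))"
  proof (intro infsum_ennreal_mono)
    fix u v assume uv: "u \<in> ?V" "v \<in> ?V"
    have upd: "?w0 (h(s := p)) = (if p = 0 then ?w0 h else ?w1 h * ipow a p)" if "h \<in> ?V" for h p
      by (rule wterm_fun_upd) (use that in \<open>auto intro: finite_subset\<close>)
    show "(\<Sum>\<^sub>\<infinity>p. \<Sum>\<^sub>\<infinity>q\<in>-{p}. ?N (q - p) (?c u v) * (?w0 (u(s := p)) * ?w0 (v(s := q))))
      \<le> ?w0 u * (?w1 v * C) + (?w1 u * C) * ?w0 v + ennreal (2 powr (a + 1)) * ((?w1 u * C) * (?w1 v * C))"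
      unfolding upd[OF uv(1)] upd[OF uv(2)] C_def by (rule infsum_two_coordinates_le[OF n a])
  qed
  also have "\<dots> = infsum ?w0 ?V * (infsum ?w1 ?V * C) + (infsum ?w1 ?V * C) * infsum ?w0 ?V
      + ennreal (2 powr (a + 1)) * ((infsum ?w1 ?V * C) * (infsum ?w1 ?V * C))"
    by (simp only: infsum_ennreal_add infsum_ennreal_product infsum_ennreal_cmult infsum_ennreal_cmult_right)
  also have "infsum ?w0 ?V = P"
    unfolding P_def C_def wterm_def by (rule infsum_prod_supp_subset) simp
  also have "infsum ?w1 ?V * C = Q"
  proof -
    have "infsum ?w1 ?V = (\<Sum>w\<in>Pow ({1..d} - {s}). ennreal (\<gamma> (insert s w)) * C ^ card w)"
      unfolding C_def wterm_def by (rule infsum_prod_supp_subset) simp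
    then show ?thesis
      by (simp add: Q_def sum_distrib_left mult_ac)
  qed
  finally show ?thesis .
qed

lemma exists_le_average_ennreal:
  fixes f :: "'a \<Rightarrow> ennreal"
  assumes "finite Y" "Y \<noteq> {}" "0 \<le> M" "sum f Y \<le> ennreal M"
  shows "\<exists>y\<in>Y. f y \<le> ennreal (M / real (card Y))"
proof -
  have c: "real (card Y) > 0"
    using assms by (simp add: card_gt_0_iff)
  obtain y where y: "y \<in> Y" "\<And>x. x \<in> Y \<Longrightarrow> f y \<le> f x"
    using ex_min_if_finite[of "f ` Y"] assms by (auto simp: not_less)
  have "ennreal (real (card Y)) * f y \<le> sum f Y"
    using sum_bounded_below[of Y "f y" f] y by (simp add: ennreal_of_nat_eq_real_of_nat)
  also note assms(4)
  finally have le: "ennreal (real (card Y)) * f y \<le> ennreal M" .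
  show ?thesis
  proof (cases "f y")
    case (real r)
    then have "ennreal (real (card Y) * r) \<le> ennreal M"
      using le by (simp add: ennreal_mult)
    then have "real (card Y) * r \<le> M"
      using assms by simp
    then have "r \<le> M / real (card Y)"
      using c by (simp add: field_simps)
    then show ?thesis
      using y real by (auto intro!: bexI[of _ y] ennreal_leI)
  next
    \<comment> \<open>An infinite minimum is impossible: multiplied by the positive cardinality it
      would exceed the finite bound \<open>M\<close>.\<close>
    case top
    with le c show ?thesis
      by (simp add: ennreal_mult_top top_unique)
  qed
qed

section \<open>Passing from exponent \<open>\<alpha> * lam\<close> back to
  \<open>\<alpha>\<close>\<close>

lemma rprime_powr: "rprime \<alpha> h powr lam = rprime (\<alpha> * lam) h"
  unfolding rprime_def by (simp add: prod_powr_distrib powr_powr)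

lemma rprime_nonneg: "rprime \<alpha> h \<ge> 0"
  by (simp add: rprime_def prod_nonneg)

text \<open>The double sum is read as one sum over pairs, so that Jensen's inequality applies once.
  The \<open>lam\<close>-th power of each term is the term for weights
  \<open>\<gamma> u powr lam\<close> and exponent \<open>\<alpha> * lam\<close>.\<close>

lemma pair_sum_powr_le:
  assumes \<gamma>: "\<And>u. u \<subseteq> {1..d} \<Longrightarrow> 0 \<le> \<gamma> u" and s: "s \<le> d"
    and lam: "0 < lam" "lam \<le> 1" and M: "0 \<le> M"
    and le: "pair_sum n d s (\<alpha> * lam) (\<lambda>u. \<gamma> u powr lam) z \<le> ennreal M"
  shows "pair_sum n d s \<alpha> \<gamma> z \<le> ennreal (M powr (1 / lam))"
proof -
  let ?L = "{l \<in> vecs s. l s \<noteq> 0 \<and> [dotp s l z = 0] (mod int n)}"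
  let ?F = "\<lambda>h. \<gamma> (supp h) / rprime \<alpha> h"
  let ?G = "\<lambda>h. \<gamma> (supp h) powr lam / rprime (\<alpha> * lam) h"
  have F: "?F h \<ge> 0" if "h \<in> vecs d" for h
    using that \<gamma> by (auto simp: vecs_eq_supp rprime_nonneg)
  have mem: "(\<lambda>j. h j + l j) \<in> vecs d" if "h \<in> vecs d" "l \<in> ?L" for h l
    using that s by (auto simp: vecs_def)
  have FG: "?F h powr lam = ?G h" if "h \<in> vecs d" for h
    using that \<gamma> by (subst powr_divide) (auto simp: rprime_nonneg rprime_powr vecs_eq_supp)
  have "pair_sum n d s \<alpha> \<gamma> z = (\<Sum>\<^sub>\<infinity>h\<in>vecs d. \<Sum>\<^sub>\<infinity>l\<in>?L. ennreal (?F h * ?F (\<lambda>j. h j + l j)))"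
    unfolding pair_sum_def
    by (intro infsum_cong, subst ennreal_mult) (auto simp: F mem ennreal_divide_rprime wterm_def)
  also have "\<dots> = (\<Sum>\<^sub>\<infinity>x\<in>vecs d \<times> ?L. ennreal (case x of (h, l) \<Rightarrow> ?F h * ?F (\<lambda>j. h j + l j)))"
    unfolding infsum_ennreal_Sigma by (rule infsum_cong) auto
  also have "\<dots> \<le> ennreal (M powr (1 / lam))"
  proof (rule infsum_le_powr_of_infsum_powr_le[OF _ lam M])
    show "0 \<le> (case x of (h, l) \<Rightarrow> ?F h * ?F (\<lambda>j. h j + l j))" if x: "x \<in> vecs d \<times> ?L" for x
    proof -
      obtain h l where "x = (h, l)" "h \<in> vecs d" "l \<in> ?L"
        using x by auto
      then show ?thesis
        using F[of h] F[OF mem[of h l]] by (simp only: prod.case) (rule mult_nonneg_nonneg, auto)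
    qed
    have "(\<Sum>\<^sub>\<infinity>x\<in>vecs d \<times> ?L. ennreal ((case x of (h, l) \<Rightarrow> ?F h * ?F (\<lambda>j. h j + l j)) powr lam))
      = (\<Sum>\<^sub>\<infinity>(h, l)\<in>vecs d \<times> ?L. wterm (\<lambda>u. \<gamma> u powr lam) (\<alpha> * lam) h * wterm (\<lambda>u. \<gamma> u powr lam) (\<alpha> * lam) (\<lambda>j. h j + l j))"
    proof (rule infsum_cong)
      fix x assume "x \<in> vecs d \<times> ?L"
      then obtain h l where x: "x = (h, l)" and h: "h \<in> vecs d" and l: "l \<in> ?L"
        by auto
      have "(?F h * ?F (\<lambda>j. h j + l j)) powr lam = ?G h * ?G (\<lambda>j. h j + l j)"
        using F[OF h] F[OF mem[OF h l]] FG[OF h] FG[OF mem[OF h l]] by (simp only: powr_mult)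
      then have "ennreal ((?F h * ?F (\<lambda>j. h j + l j)) powr lam) = ennreal (?G h) * ennreal (?G (\<lambda>j. h j + l j))"
        by (simp only:) (intro ennreal_mult divide_nonneg_nonneg rprime_nonneg powr_ge_zero)
      then show "ennreal ((case x of (h, l) \<Rightarrow> ?F h * ?F (\<lambda>j. h j + l j)) powr lam)
        = (case x of (h, l) \<Rightarrow> wterm (\<lambda>u. \<gamma> u powr lam) (\<alpha> * lam) h * wterm (\<lambda>u. \<gamma> u powr lam) (\<alpha> * lam) (\<lambda>j. h j + l j))"
        by (simp only: x prod.case ennreal_divide_rprime wterm_def)
    qed
    also have "\<dots> = pair_sum n d s (\<alpha> * lam) (\<lambda>u. \<gamma> u powr lam) z"
      unfolding pair_sum_def by (rule infsum_ennreal_Sigma[symmetric])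
    finally show "(\<Sum>\<^sub>\<infinity>x\<in>vecs d \<times> ?L. ennreal ((case x of (h, l) \<Rightarrow> ?F h * ?F (\<lambda>j. h j + l j)) powr lam)) \<le> ennreal M"
      using le by simp
  qed
  finally show ?thesis .
qed

section \<open>Subset sums and the bound for one component\<close>

lemma sum_Pow_split:
  fixes f :: "'a set \<Rightarrow> 'b :: comm_monoid_add"
  assumes "finite A" "s \<in> A"
  shows "sum f (Pow A) = (\<Sum>w\<in>Pow (A - {s}). f w) + (\<Sum>w\<in>Pow (A - {s}). f (insert s w))"
proof -
  have "A = insert s (A - {s})"
    using assms by auto
  then have "Pow A = Pow (A - {s}) \<union> insert s ` Pow (A - {s})"
    using Pow_insert[of s "A - {s}"] by simp
  then have "sum f (Pow A) = sum f (Pow (A - {s})) + sum f (insert s ` Pow (A - {s}))"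
    using assms by (simp only:) (rule sum.union_disjoint, auto)
  also have "sum f (insert s ` Pow (A - {s})) = (\<Sum>w\<in>Pow (A - {s}). f (insert s w))"
    by (rule sum.reindex_cong[of "insert s"]) (auto simp: inj_on_def)
  finally show ?thesis .
qed

text \<open>Double counting of the pairs of a set \<open>u\<close> and an element \<open>s\<close>
  of it: each \<open>u\<close> occurs \<open>card u\<close> times. This is the origin of the
  cardinality factor in the final bound.\<close>

lemma sum_Pow_insert_eq_sum_card:
  fixes f :: "'a set \<Rightarrow> real"
  assumes "finite A"
  shows "(\<Sum>s\<in>A. \<Sum>w\<in>Pow (A - {s}). f (insert s w)) = (\<Sum>u\<in>Pow A - {{}}. real (card u) * f u)"
proof -
  have "(\<Sum>w\<in>Pow (A - {s}). f (insert s w)) = (\<Sum>u\<in>Pow A. if s \<in> u then f u else 0)" if "s \<in> A" for s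
  proof -
    have "(\<Sum>w\<in>Pow (A - {s}). if s \<in> w then f w else 0) = 0"
      by (rule sum.neutral) auto
    then show ?thesis
      using sum_Pow_split[OF assms that, of "\<lambda>u. if s \<in> u then f u else 0"] by simp
  qed
  then have "(\<Sum>s\<in>A. \<Sum>w\<in>Pow (A - {s}). f (insert s w)) = (\<Sum>s\<in>A. \<Sum>u\<in>Pow A. if s \<in> u then f u else 0)"
    by simp
  also have "\<dots> = (\<Sum>u\<in>Pow A. \<Sum>s\<in>A. if s \<in> u then f u else 0)"
    by (rule sum.swap)
  also have "\<dots> = (\<Sum>u\<in>Pow A. real (card u) * f u)"
    by (rule sum.cong) (auto simp: sum.If_cases[OF assms] Int_absorb1)
  also have "\<dots> = (\<Sum>u\<in>Pow A - {{}}. real (card u) * f u)"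
    by (rule sum.mono_neutral_right) (use assms in auto)
  finally show ?thesis .
qed

lemma exists_pair_sum_le:
  fixes \<gamma> :: "nat set \<Rightarrow> real"
  assumes n: "n \<ge> 2" and a: "a > 1" and s: "s \<in> {1..d}"
    and \<gamma>: "\<And>u. 0 \<le> \<gamma> u"
  defines "f \<equiv> \<lambda>u. \<gamma> u * (2 * zeta a) ^ card u"
  shows "\<exists>y\<in>Un_set n. pair_sum n d s a \<gamma> (z(s := y)) \<le> ennreal ((2 powr (2 * a + 1) + 1) / real (totient n)
    * (\<Sum>w\<in>Pow ({1..d} - {s}). f (insert s w)) * (\<Sum>u\<in>Pow {1..d}. f u))"
proof -
  define P where "P = (\<Sum>w\<in>Pow ({1..d} - {s}). f w)"
  define Q where "Q = (\<Sum>w\<in>Pow ({1..d} - {s}). f (insert s w))"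
  define C where "C = (\<Sum>\<^sub>\<infinity>k\<in>-{0}. ipow a k)"
  have Z: "zeta a > 0"
    using zeta_pos[OF a] .
  have C: "C = ennreal (2 * zeta a)"
    unfolding C_def by (rule infsum_ipow[OF a])
  have f: "f u \<ge> 0" for u
    using \<gamma> Z by (simp add: f_def)
  have P0: "P \<ge> 0" and Q0: "Q \<ge> 0"
    using f by (auto simp: P_def Q_def intro!: sum_nonneg)
  have PQ: "P + Q = (\<Sum>u\<in>Pow {1..d}. f u)"
    unfolding P_def Q_def using sum_Pow_split[of "{1..d}" s f] s by simp
  have fe: "ennreal (\<gamma> u) * C ^ card u = ennreal (f u)" for u
  proof -
    have Z0: "0 \<le> 2 * zeta a"
      using Z by simp
    show ?thesis
      unfolding f_def C ennreal_power[OF Z0] by (intro ennreal_mult[symmetric] \<gamma> zero_le_power Z0)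
  qed
  have P: "(\<Sum>w\<in>Pow ({1..d} - {s}). ennreal (\<gamma> w) * C ^ card w) = ennreal P"
    unfolding P_def fe by (rule sum_ennreal[OF f])
  have "(\<Sum>w\<in>Pow ({1..d} - {s}). ennreal (\<gamma> (insert s w)) * C ^ Suc (card w))
      = (\<Sum>w\<in>Pow ({1..d} - {s}). ennreal (f (insert s w)))"
  proof (rule sum.cong[OF refl])
    fix w assume w: "w \<in> Pow ({1..d} - {s})"
    then have "finite w" "s \<notin> w"
      by (auto intro: finite_subset)
    then show "ennreal (\<gamma> (insert s w)) * C ^ Suc (card w) = ennreal (f (insert s w))"
      using fe[of "insert s w"] by simp
  qed
  also have "\<dots> = ennreal Q"
    unfolding Q_def by (rule sum_ennreal[OF f])
  finally have Q: "(\<Sum>w\<in>Pow ({1..d} - {s}). ennreal (\<gamma> (insert s w)) * C ^ Suc (card w)) = ennreal Q" .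
  let ?K = "(2 powr (2 * a + 1) + 1) * Q * (P + Q)"
  have "(\<Sum>y\<in>Un_set n. pair_sum n d s a \<gamma> (z(s := y)))
      \<le> ennreal P * ennreal Q + ennreal Q * ennreal P + ennreal (2 powr (a + 1)) * (ennreal Q * ennreal Q)"
    using sum_pair_sum_le[OF n a s, of \<gamma> z] unfolding C_def[symmetric] P Q .
  also have "\<dots> = ennreal (P * Q + Q * P + 2 powr (a + 1) * (Q * Q))"
    using P0 Q0 by (simp flip: ennreal_mult ennreal_plus)
  \<comment> \<open>The left side is \<open>2 * P * Q\<close> plus \<open>2 powr (a + 1)\<close>
    times the square of \<open>Q\<close>. Both coefficients are at most
    \<open>2 powr (2 * a + 1) + 1\<close>, so \<open>Q * (P + Q)\<close> can be factored out, and
    \<open>P + Q\<close> is the sum over all subsets.\<close>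
  also have "\<dots> \<le> ennreal ?K"
  proof (rule ennreal_leI)
    have k: "2 powr (a + 1) \<le> 2 powr (2 * a + 1)"
      using a by (intro powr_mono) auto
    have "(2::real) \<le> 2 powr (a + 1)"
      using powr_mono[of 1 "a + 1" "2::real"] a by simp
    then have "2 \<le> 2 powr (2 * a + 1) + (1::real)"
      using k by linarith
    then have "2 * (Q * P) \<le> (2 powr (2 * a + 1) + 1) * (Q * P)"
      using P0 Q0 by (intro mult_right_mono) auto
    moreover have "2 powr (a + 1) * (Q * Q) \<le> (2 powr (2 * a + 1) + 1) * (Q * Q)"
    proof (rule mult_right_mono)
      show "2 powr (a + 1) \<le> 2 powr (2 * a + 1) + 1"
        using k by linarith
    qed (use Q0 in simp)
    ultimately show "P * Q + Q * P + 2 powr (a + 1) * (Q * Q) \<le> ?K"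
      by (simp add: algebra_simps)
  qed
  finally have "\<exists>y\<in>Un_set n. pair_sum n d s a \<gamma> (z(s := y)) \<le> ennreal (?K / real (card (Un_set n)))"
  proof (intro exists_le_average_ennreal)
    show "Un_set n \<noteq> {}"
      using n by (auto simp: Un_set_def intro!: exI[of _ 1])
  qed (use P0 Q0 in auto)
  then show ?thesis
    unfolding card_Un_set[OF n] PQ Q_def[symmetric] by simp
qed

theorem theorem1:
  fixes n d :: nat and \<alpha> lam :: real and \<gamma> :: "nat set \<Rightarrow> real" and z :: "nat \<Rightarrow> int"
  assumes "n \<ge> 2" and "d \<ge> 1" and "\<alpha> > 1"
    and "\<forall>u. finite u \<and> 0 \<notin> u \<longrightarrow> \<gamma> u > 0" and "\<gamma> {} = 1"
    and "cbc n d \<alpha> \<gamma> z"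
    and "1 / \<alpha> < lam" and "lam \<le> 1"
  shows "S_err n d \<alpha> \<gamma> z \<le> ennreal (
     ((2 powr (2 * \<alpha> * lam + 1) + 1) / real (totient n)
       * (\<Sum>u\<in>Pow {1..d} - {{}}. real (card u) * \<gamma> u powr lam * (2 * zeta (\<alpha> * lam)) ^ card u)
       * (\<Sum>u\<in>Pow {1..d}. \<gamma> u powr lam * (2 * zeta (\<alpha> * lam)) ^ card u)) powr (1 / lam))"
proof -
  let ?a = "\<alpha> * lam"
  let ?\<gamma> = "\<lambda>u. \<gamma> u powr lam"
  let ?f = "\<lambda>u. ?\<gamma> u * (2 * zeta ?a) ^ card u"
  let ?Q = "\<lambda>s. \<Sum>w\<in>Pow ({1..d} - {s}). ?f (insert s w)"
  let ?X = "\<lambda>s. (2 powr (2 * ?a + 1) + 1) / real (totient n) * ?Q s * (\<Sum>u\<in>Pow {1..d}. ?f u)"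
  have lam: "0 < lam"
    using assms(3,7) by (smt (verit) divide_pos_pos)
  have a: "?a > 1"
    using assms(3,7) by (simp add: field_simps)
  have f: "?f u \<ge> 0" for u
    using zeta_pos[OF a] by simp
  have X: "?X s \<ge> 0" for s
    by (intro mult_nonneg_nonneg sum_nonneg f) auto
  have "pair_sum n d s \<alpha> \<gamma> z \<le> ennreal (?X s powr (1 / lam))" if s: "s \<in> {1..d}" for s
  proof -
    \<comment> \<open>This \<open>y\<close> is good for the powered weights and need not be the
      minimiser. Minimality of \<open>z s\<close> for the original criterion then compares
      \<open>z\<close> with \<open>z(s := y)\<close>, and Jensen's inequality is applied only at
      \<open>y\<close>. Components of \<open>z\<close> after \<open>s\<close> do not enter
      \<open>dotp s\<close>.\<close>
    obtain y where y: "y \<in> Un_set n" "pair_sum n d s ?a ?\<gamma> (z(s := y)) \<le> ennreal (?X s)"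
      using exists_pair_sum_le[OF assms(1) a s, of ?\<gamma> z] by auto
    have "pair_sum n d s \<alpha> \<gamma> z = T_crit n d s \<alpha> \<gamma> z"
      using s assms(3) by (intro T_crit_eq_pair_sum[symmetric]) auto
    also have "\<dots> \<le> T_crit n d s \<alpha> \<gamma> (z(s := y))"
      using assms(6) s y by (simp add: cbc_def)
    also have "\<dots> = pair_sum n d s \<alpha> \<gamma> (z(s := y))"
      using s assms(3) by (intro T_crit_eq_pair_sum) auto
    also have "\<dots> \<le> ennreal (?X s powr (1 / lam))"
    proof (rule pair_sum_powr_le[OF _ _ lam assms(8) X y(2)])
      fix u :: "nat set" assume "u \<subseteq> {1..d}"
      then have "finite u" "0 \<notin> u"
        by (auto intro: finite_subset)
      then show "0 \<le> \<gamma> u"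
        using assms(4) by (simp add: less_imp_le)
    qed (use s in auto)
    finally show ?thesis .
  qed
  then have "S_err n d \<alpha> \<gamma> z \<le> (\<Sum>s\<in>{1..d}. ennreal (?X s powr (1 / lam)))"
    unfolding S_err_eq_sum_pair_sum by (rule sum_mono)
  also have "\<dots> = ennreal (\<Sum>s\<in>{1..d}. ?X s powr (1 / lam))"
    by (rule sum_ennreal) simp
  \<comment> \<open>A second use of superadditivity of the power \<open>1 / lam\<close>, now over
    the components, moves the sum over \<open>s\<close> inside the power.\<close>
  also have "\<dots> \<le> ennreal ((\<Sum>s\<in>{1..d}. ?X s) powr (1 / lam))"
    by (intro ennreal_leI sum_powr_le_powr_sum X) (use lam assms(8) in simp)
  also have "(\<Sum>s\<in>{1..d}. ?X s) = (2 powr (2 * ?a + 1) + 1) / real (totient n) * (\<Sum>s\<in>{1..d}. ?Q s) * (\<Sum>u\<in>Pow {1..d}. ?f u)"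
    by (simp only: sum_distrib_left[symmetric] sum_distrib_right[symmetric])
  also have "(\<Sum>s\<in>{1..d}. ?Q s) = (\<Sum>u\<in>Pow {1..d} - {{}}. real (card u) * ?f u)"
    by (rule sum_Pow_insert_eq_sum_card) simp
  finally show ?thesis
    by (simp only: mult.assoc)
qed

end
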